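(* If $\dim E=n-1\equiv6\pmod 8$, every non-zero charge spin representation $\rho$ of the Heisenberg algebra $\mathfrak{heis}_b=E^*+E+\mathbb R\mathrm p$ is given by $$\rho(\mathrm p)=\sqrt2\begin{pmatrix}0&h_1\mathrm{Id}+h_2\,\omega\\0&0\end{pmatrix},$$ $$\rho(e)=\frac12\begin{pmatrix}h_3(e)\mathrm{Id}-h_1e+h_2\,e\,\omega+h_4(e)\,\omega&2\rho_{12}(e)\\0&h_3(e)\mathrm{Id}+h_1e+h_2\,e\,\omega-h_4(e)\,\omega\end{pmatrix}\qquad(e\in E),$$ where $\rho_{12}\in\mathrm{Hom}_{\mathbb R}(E,\mathrm{End}_{\mathbb R}(S_{0,n-1}))$ is $(\rho_{11},\rho_{22})$-suitable ($\rho_{11},\rho_{22}$ being the diagonal blocks of $\rho$ on $E$) and, for some sign $\varepsilon\in\{+1,-1\}$, one of the following holds: (a) $h_2\in\mathbb H$ satisfies $\mathrm{Im}\,h_2\ne0$; $h_3\in\mathrm{Hom}_{\mathbb R}(E,\mathbb H)$ is such that the linear map $\mathrm{Im}\,h_3:E\to\mathrm{Im}\,\mathbb H$ has rank at most $1$ or $\mathrm{Im}\,h_3(E)=(\mathrm{Im}\,h_2)^\perp$; and $$h_1=\varepsilon\Big(|\mathrm{Im}\,h_2|-\mathrm{Re}\,h_2\,\frac{\mathrm{Im}\,h_2}{|\mathrm{Im}\,h_2|}\Big),\qquad h_4(e)=\varepsilon\,\frac{\mathrm{Im}\,h_2\times\mathrm{Im}\,h_3(e)}{|\mathrm{Im}\,h_2|};$$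 (b) $h_1\in\mathbb H$ satisfies $\mathrm{Re}\,h_1=0$ and $\mathrm{Im}\,h_1\neq0$; $h_3\in\mathrm{Hom}_{\mathbb R}(E,\mathbb H)$ is such that $\mathrm{Im}\,h_3:E\to\mathrm{Im}\,\mathbb H$ has rank at most $1$ or $\mathrm{Im}\,h_3(E)=(\mathrm{Im}\,h_1)^\perp$; and $$h_2=\varepsilon\,|\mathrm{Im}\,h_1|,\qquad h_4(e)=-\varepsilon\,\frac{\mathrm{Im}\,h_1\times\mathrm{Im}\,h_3(e)}{|\mathrm{Im}\,h_1|}.$$
   Context: $E=\mathbb R^{0,n-1}$ is an $(n-1)$-dimensional real vector space with a negative definite inner product $\langle\cdot,\cdot\rangle$; $e^\flat=\langle e,\cdot\rangle\in E^*$. $b$ is a non-degenerate symmetric bilinear form on $E$ and $B\in\mathrm{End}_{\mathbb R}(E)$ is defined by $b(\cdot,\cdot)=-\langle B\cdot,\cdot\rangle$. The Heisenberg algebra $\mathfrak{heis}_b=E^*+E+\mathbb R\mathrm p$ has as only non-trivial brackets $[e^\flat,f]=b(e,f)\mathrm p$ ($e,f\in E$). $\mathrm{Cl}_{0,n-1}$ is the Clifford algebra of $E$ with convention $v^2=-\langle v,v\rangle$ (so unit vectors of $E$ square to $+1$), $S_{0,n-1}$ is a real irreducible $\mathrm{Cl}_{0,n-1}$-module, on which a vector $e\in E$ acts by Clifford multiplication (denoted again $e$). $\omega$ denotes the action on $S_{0,n-1}$ of the volume form $e_1\cdots e_{n-1}$ ($e_i$ an orthonormal basis of $E$). The even Schur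 algebra $\mathcal C^\circ_{0,n-1}$ is the algebra of endomorphisms of $S_{0,n-1}$ commuting with Clifford multiplication by all vectors; for $n-1\equiv6\pmod8$ it is isomorphic to the quaternions $\mathbb H$, and elements of $\mathbb H$ are regarded as endomorphisms of $S_{0,n-1}$ through such an identification. $\mathrm{Re}$, $\mathrm{Im}$ denote the real and imaginary parts of quaternions, $\mathrm{Im}\,\mathbb H\cong\mathbb R^3$ carries its standard norm $|\cdot|$, orthogonality and vector product $a\times a'=\frac12[a,a']$. Let $\mathfrak m=E+\mathbb R\mathrm p+\mathbb R\mathrm q$ be Minkowski space ($\mathrm p,\mathrm q$ isotropic, orthogonal to $E$, $\langle\mathrm p,\mathrm q\rangle=1$) and $S=S_{1,n}$ the real irreducible $\mathrm{Cl}(\mathfrak m)$-module. It is identified, as a vector space, with $S=S_-+S_+=S_{0,n-1}+S_{0,n-1}$ (endomorphisms written as $2\times2$ block matrices) in such a way that $\mathrm p\wedge e\in\mathfrak{so}(\mathfrak m)$ acts as $\begin{pmatrix}0&\sqrt2\,e\\0&0\end{pmatrix}$. A Lie algebra representation $\rho:\mathfrak{heis}_b\to\mathfrak{gl}_{\mathbb R}(S)$ is called spin if $\rho(e^\flat)=\begin{pmatrix}0&\sqrt2\,Be\\0&0\end{pmatrix}$ for all $e\in E$ (the spin action of $\mathrm p\wedge Be$). It has non-zero charge if $\rho(\mathrm p)\neq0$. For fixed $\rho_{11},\rho_{22}\in\mathrm{Hom}_{\mathbb R}(E,\mathrm{End}_{\mathbb R}(S_{0,n-1}))$, a map $\rho_{12}\in\mathrm{Hom}_{\mathbb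 R}(E,\mathrm{End}_{\mathbb R}(S_{0,n-1}))$ is $(\rho_{11},\rho_{22})$-suitable if the bilinear map $e\otimes f\mapsto\rho_{11}(e)\circ\rho_{12}(f)-\rho_{12}(f)\circ\rho_{22}(e)$ on $E\otimes E$ is symmetric. *)

theory Defs
  imports "HOL-Analysis.Analysis"
begin

section \<open>Endomorphisms of a real vector space\<close>

typedef (overloaded) 's endo = "{f :: 's::real_vector \<Rightarrow> 's. linear f}"
  morphisms endo_app Endo
  using linear_id by blast

setup_lifting type_definition_endo

instantiation endo :: (real_vector) real_algebra
begin

lift_definition zero_endo :: "'a endo" is "\<lambda>x. 0" by (rule linear_zero)
lift_definition plus_endo :: "'a endo \<Rightarrow> 'a endo \<Rightarrow> 'a endo" is "\<lambda>f g x. f x + g x"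
  by (rule linear_compose_add)
lift_definition uminus_endo :: "'a endo \<Rightarrow> 'a endo" is "\<lambda>f x. - f x"
  by (rule linear_compose_neg)
lift_definition minus_endo :: "'a endo \<Rightarrow> 'a endo \<Rightarrow> 'a endo" is "\<lambda>f g x. f x - g x"
  by (rule linear_compose_sub)
lift_definition times_endo :: "'a endo \<Rightarrow> 'a endo \<Rightarrow> 'a endo" is "\<lambda>f g x. f (g x)"
  using linear_compose by (fastforce simp: o_def)
lift_definition scaleR_endo :: "real \<Rightarrow> 'a endo \<Rightarrow> 'a endo" is "\<lambda>c f x. c *\<^sub>R f x"
  by (rule linear_compose_scale_right)

instance
  by (intro_classes; transfer)
     (auto simp: fun_eq_iff algebra_simps linear_add linear_scale)

end

instantiation endo :: (real_vector) monoid_mult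
begin

lift_definition one_endo :: "'a endo" is "\<lambda>x. x" by (rule linear_ident)

instance by (intro_classes; transfer) auto

end

text \<open>Block matrices; the first summand of \<open>'s \<times> 's\<close> is \<open>S\<^sub>-\<close>, the second is \<open>S\<^sub>+\<close>.\<close>

lift_definition block ::
  "'s::real_vector endo \<Rightarrow> 's endo \<Rightarrow> 's endo \<Rightarrow> 's endo \<Rightarrow> ('s \<times> 's) endo"
  is "\<lambda>A B C D (x, y). (A x + B y, C x + D y)"
  by (auto intro!: linearI simp: linear_add linear_scale algebra_simps)

text \<open>The classes here allow the zero algebra.\<close>

definition alg_hom :: "('a::{real_algebra, monoid_mult} \<Rightarrow> 'b::{real_algebra, monoid_mult}) \<Rightarrow> bool"
  where "alg_hom F \<longleftrightarrow> linear F \<and> F 1 = 1 \<and> (\<forall>x y. F (x * y) = F x * F y)"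


section \<open>The negative definite space and its Clifford algebra\<close>

text \<open>A Euclidean space carries the negative definite product \<open>-(x \<bullet> y)\<close>; up to isometry every
  finite-dimensional negative definite space arises this way.\<close>

definition neg_inner :: "'e::euclidean_space \<Rightarrow> 'e \<Rightarrow> real"
  where "neg_inner x y = - (x \<bullet> y)"

text \<open>The Clifford algebra is the unital associative real algebra generated by the vectors of
  \<open>'e\<close>, subject to the linear relations of \<open>'e\<close> and to \<open>v\<^sup>2 = - neg_inner v v\<close>; that is, the
  tensor algebra modulo the Clifford relation.\<close>

datatype 'e cterm = Gen 'e | Scal real | Add "'e cterm" "'e cterm" | Mul "'e cterm" "'e cterm"

inductive clifford_rel :: "'e::euclidean_space cterm \<Rightarrow> 'e cterm \<Rightarrow> bool" where
  refl: "clifford_rel x x"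
| sym: "clifford_rel x y \<Longrightarrow> clifford_rel y x"
| trans: "clifford_rel x y \<Longrightarrow> clifford_rel y z \<Longrightarrow> clifford_rel x z"
| cong_add: "clifford_rel x x' \<Longrightarrow> clifford_rel y y' \<Longrightarrow> clifford_rel (Add x y) (Add x' y')"
| cong_mul: "clifford_rel x x' \<Longrightarrow> clifford_rel y y' \<Longrightarrow> clifford_rel (Mul x y) (Mul x' y')"
| add_assoc: "clifford_rel (Add (Add x y) z) (Add x (Add y z))"
| add_commute: "clifford_rel (Add x y) (Add y x)"
| add_zero: "clifford_rel (Add (Scal 0) x) x"
| add_neg: "clifford_rel (Add (Mul (Scal (-1)) x) x) (Scal 0)"
| mul_assoc: "clifford_rel (Mul (Mul x y) z) (Mul x (Mul y z))"
| one_mul: "clifford_rel (Mul (Scal 1) x) x"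
| mul_one: "clifford_rel (Mul x (Scal 1)) x"
| distrib_left: "clifford_rel (Mul x (Add y z)) (Add (Mul x y) (Mul x z))"
| distrib_right: "clifford_rel (Mul (Add x y) z) (Add (Mul x z) (Mul y z))"
| scal_add: "clifford_rel (Scal (r + s)) (Add (Scal r) (Scal s))"
| scal_mul: "clifford_rel (Scal (r * s)) (Mul (Scal r) (Scal s))"
| scal_central: "clifford_rel (Mul (Scal r) x) (Mul x (Scal r))"
| gen_add: "clifford_rel (Gen (v + w)) (Add (Gen v) (Gen w))"
| gen_scale: "clifford_rel (Gen (r *\<^sub>R v)) (Mul (Scal r) (Gen v))"
| gen_square: "clifford_rel (Mul (Gen v) (Gen v)) (Scal (- neg_inner v v))"

quotient_type (overloaded) 'e clifford = "'e::euclidean_space cterm" / clifford_rel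
  by (intro equivpI reflpI sympI transpI)
     (auto intro: clifford_rel.refl clifford_rel.sym clifford_rel.trans)

lift_definition cl_vec :: "'e::euclidean_space \<Rightarrow> 'e clifford" is Gen .

instantiation clifford :: (euclidean_space) real_algebra
begin

lift_definition zero_clifford :: "'a clifford" is "Scal 0" .
lift_definition plus_clifford :: "'a clifford \<Rightarrow> 'a clifford \<Rightarrow> 'a clifford" is Add
  by (rule clifford_rel.cong_add)
lift_definition times_clifford :: "'a clifford \<Rightarrow> 'a clifford \<Rightarrow> 'a clifford" is Mul
  by (rule clifford_rel.cong_mul)
lift_definition scaleR_clifford :: "real \<Rightarrow> 'a clifford \<Rightarrow> 'a clifford" is "\<lambda>r. Mul (Scal r)"
  by (rule clifford_rel.cong_mul[OF clifford_rel.refl])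
lift_definition uminus_clifford :: "'a clifford \<Rightarrow> 'a clifford" is "Mul (Scal (-1))"
  by (rule clifford_rel.cong_mul[OF clifford_rel.refl])
definition minus_clifford :: "'a clifford \<Rightarrow> 'a clifford \<Rightarrow> 'a clifford"
  where "minus_clifford x y = x + - y"

instance
proof (intro_classes, unfold minus_clifford_def)
  fix a b c :: "'a clifford" and r s :: real
  show "a + b + c = a + (b + c)" by transfer (rule clifford_rel.add_assoc)
  show "a + b = b + a" by transfer (rule clifford_rel.add_commute)
  show "0 + a = a" by transfer (rule clifford_rel.add_zero)
  show "- a + a = 0" by transfer (rule clifford_rel.add_neg)
  show "a + - b = a + - b" ..
  show "a * b * c = a * (b * c)" by transfer (rule clifford_rel.mul_assoc)
  show "(a + b) * c = a * c + b * c" by transfer (rule clifford_rel.distrib_right)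
  show "a * (b + c) = a * b + a * c" by transfer (rule clifford_rel.distrib_left)
  show "r *\<^sub>R (a + b) = r *\<^sub>R a + r *\<^sub>R b" by transfer (rule clifford_rel.distrib_left)
  show "(r + s) *\<^sub>R a = r *\<^sub>R a + s *\<^sub>R a"
    by transfer (meson clifford_rel.intros)
  show "r *\<^sub>R s *\<^sub>R a = (r * s) *\<^sub>R a"
    by transfer (meson clifford_rel.intros)
  show "1 *\<^sub>R a = a" by transfer (rule clifford_rel.one_mul)
  show "r *\<^sub>R a * b = r *\<^sub>R (a * b)" by transfer (rule clifford_rel.mul_assoc)
  show "a * r *\<^sub>R b = r *\<^sub>R (a * b)"
    by transfer (meson clifford_rel.intros)
qed

end

instantiation clifford :: (euclidean_space) monoid_mult
begin

lift_definition one_clifford :: "'a clifford" is "Scal 1" .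

instance
  by (intro_classes; transfer) (rule clifford_rel.mul_assoc clifford_rel.one_mul clifford_rel.mul_one)+

end

lemma linear_cl_vec: "linear cl_vec"
  by (rule linearI; transfer) (rule clifford_rel.gen_add clifford_rel.gen_scale)+

lemma cl_vec_square: "cl_vec v * cl_vec v = (- neg_inner v v) *\<^sub>R 1"
  by transfer (meson clifford_rel.intros)

primrec cterm_eval :: "('e \<Rightarrow> 'a::{real_algebra, monoid_mult}) \<Rightarrow> 'e cterm \<Rightarrow> 'a" where
  "cterm_eval f (Gen v) = f v"
| "cterm_eval f (Scal r) = r *\<^sub>R 1"
| "cterm_eval f (Add x y) = cterm_eval f x + cterm_eval f y"
| "cterm_eval f (Mul x y) = cterm_eval f x * cterm_eval f y"

lemma cterm_eval_cong:
  assumes "clifford_rel x y" and "linear f" and "\<And>v. f v * f v = (- neg_inner v v) *\<^sub>R 1"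
  shows "cterm_eval f x = cterm_eval f y"
  using assms
  by (induction rule: clifford_rel.induct)
     (auto simp: algebra_simps linear_add linear_scale)

text \<open>Universal property.\<close>

proposition clifford_universal:
  fixes f :: "'e::euclidean_space \<Rightarrow> 'a::{real_algebra, monoid_mult}"
  assumes f: "linear f" "\<And>v. f v * f v = (- neg_inner v v) *\<^sub>R 1"
  shows "\<exists>!F. alg_hom F \<and> (\<forall>v. F (cl_vec v) = f v)"
proof -
  define F where "F x = cterm_eval f (rep_clifford x)" for x
  have F_abs: "F (abs_clifford t) = cterm_eval f t" for t
    unfolding F_def
    by (rule cterm_eval_cong[OF _ f])
       (metis Quotient3_clifford Quotient3_rel_rep clifford.abs_eq_iff Quotient3_abs_rep)
  have scal: "abs_clifford (Scal r) = r *\<^sub>R (1 :: 'e clifford)" for r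
    unfolding one_clifford_def scaleR_clifford.abs_eq clifford.abs_eq_iff
    by (rule clifford_rel.sym[OF clifford_rel.mul_one])
  have "alg_hom F"
    unfolding alg_hom_def
  proof (intro conjI allI linearI)
    fix x y :: "'e clifford" and r :: real
    obtain s t where xy: "x = abs_clifford s" "y = abs_clifford t"
      using that[of "rep_clifford x" "rep_clifford y"]
      by (simp add: Quotient3_abs_rep[OF Quotient3_clifford])
    show "F (x + y) = F x + F y" "F (x * y) = F x * F y" "F (r *\<^sub>R x) = r *\<^sub>R F x" "F 1 = 1"
      by (simp_all add: xy F_abs plus_clifford.abs_eq times_clifford.abs_eq
          scaleR_clifford.abs_eq one_clifford_def)
  qed
  moreover have "\<forall>v. F (cl_vec v) = f v"
    by (simp add: cl_vec.abs_eq F_abs)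
  moreover have "G = F" if G: "alg_hom G" "\<forall>v. G (cl_vec v) = f v" for G
  proof
    fix x
    have "G (abs_clifford t) = cterm_eval f t" for t
    proof (induction t)
      case (Gen v)
      then show ?case using G(2) by (simp add: cl_vec.abs_eq)
    next
      case (Scal r)
      then show ?case using G(1) by (simp add: scal alg_hom_def linear_scale)
    next
      case (Add s t)
      then show ?case using G(1)
        by (simp add: alg_hom_def linear_add flip: plus_clifford.abs_eq)
    next
      case (Mul s t)
      then show ?case using G(1) by (simp add: alg_hom_def flip: times_clifford.abs_eq)
    qed
    from this[of "rep_clifford x"] show "G x = F x"
      by (simp add: F_def Quotient3_abs_rep[OF Quotient3_clifford])
  qed
  ultimately show ?thesis by blast
qed


section \<open>Clifford modules\<close>

text \<open>A module structure on \<open>'s\<close> is an algebra homomorphism into the endomorphisms.\<close>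

definition irreducible_clifford_module ::
  "('e::euclidean_space clifford \<Rightarrow> 's::real_vector endo) \<Rightarrow> bool"
  where "irreducible_clifford_module \<pi> \<longleftrightarrow>
    alg_hom \<pi> \<and> (UNIV :: 's set) \<noteq> {0} \<and>
    (\<forall>W. subspace W \<and> (\<forall>a. \<forall>w\<in>W. endo_app (\<pi> a) w \<in> W) \<longrightarrow> W = {0} \<or> W = UNIV)"

definition even_schur_algebra ::
  "('e::euclidean_space clifford \<Rightarrow> 's::real_vector endo) \<Rightarrow> 's endo set"
  where "even_schur_algebra \<pi> = {T. \<forall>v. T * \<pi> (cl_vec v) = \<pi> (cl_vec v) * T}"

definition orthonormal_basis_list :: "'e::euclidean_space list \<Rightarrow> bool"
  where "orthonormal_basis_list es \<longleftrightarrow> length es = DIM('e) \<and>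
    (\<forall>i<length es. \<forall>j<length es. neg_inner (es ! i) (es ! j) = (if i = j then - 1 else 0))"

definition cl_volume :: "'e::euclidean_space list \<Rightarrow> 'e clifford"
  where "cl_volume es = prod_list (map cl_vec es)"


section \<open>Quaternions\<close>

datatype quat = Quat (qRe: real) (qIm: "real^3")

instantiation quat :: real_algebra_1
begin

definition "0 = Quat 0 0"
definition "1 = Quat 1 0"
definition "x + y = Quat (qRe x + qRe y) (qIm x + qIm y)"
definition "x - y = Quat (qRe x - qRe y) (qIm x - qIm y)"
definition "- x = Quat (- qRe x) (- qIm x)"
definition "r *\<^sub>R x = Quat (r * qRe x) (r *\<^sub>R qIm x)"
definition "x * y = Quat (qRe x * qRe y - qIm x \<bullet> qIm y)
  (qRe x *\<^sub>R qIm y + qRe y *\<^sub>R qIm x + cross3 (qIm x) (qIm y))"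

instance
  by intro_classes
     (simp_all add: zero_quat_def one_quat_def plus_quat_def minus_quat_def uminus_quat_def
       scaleR_quat_def times_quat_def quat.expand cross3_simps forall_3)

end

text \<open>Imaginary quaternions are vectors in \<open>real^3\<close>; \<open>cross3\<close> is half the commutator.\<close>

abbreviation imag :: "real^3 \<Rightarrow> quat"
  where "imag u \<equiv> Quat 0 u"

lemma imag_cross3: "imag (cross3 u v) = (1/2) *\<^sub>R (imag u * imag v - imag v * imag u)"
  by (simp add: minus_quat_def scaleR_quat_def times_quat_def cross3_simps forall_3)

text \<open>An identification of the quaternions with the even Schur algebra.\<close>

definition quat_identification ::
  "('e::euclidean_space clifford \<Rightarrow> 's::real_vector endo) \<Rightarrow> (quat \<Rightarrow> 's endo) \<Rightarrow> bool"
  where "quat_identification \<pi> \<phi> \<longleftrightarrow>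
    alg_hom \<phi> \<and> bij_betw \<phi> UNIV (even_schur_algebra \<pi>)"


section \<open>The Heisenberg algebra and its spin representations\<close>

lift_definition flat :: "'e::euclidean_space \<Rightarrow> ('e \<Rightarrow>\<^sub>L real)" is neg_inner
  unfolding neg_inner_def by (intro bounded_linear_minus bounded_linear_inner_right)

lemma bij_flat: "bij (flat :: 'e::euclidean_space \<Rightarrow> _)"
proof (rule bijI)
  show "inj (flat :: 'e \<Rightarrow> _)"
  proof (rule injI)
    fix x y :: 'e
    assume "flat x = flat y"
    then have "blinfun_apply (flat x) z = blinfun_apply (flat y) z" for z by simp
    then show "x = y"
      by (simp add: flat.rep_eq neg_inner_def euclidean_eq_iff[of x y])
  qed
  show "surj (flat :: 'e \<Rightarrow> _)"
  proof (rule surjI)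
    fix \<alpha> :: "'e \<Rightarrow>\<^sub>L real"
    show "flat (- (\<Sum>i\<in>Basis. \<alpha> i *\<^sub>R i)) = \<alpha>"
      by (rule blinfun_euclidean_eqI)
         (simp add: flat.rep_eq neg_inner_def inner_sum_left inner_Basis if_distrib cong: if_cong)
  qed
qed

text \<open>Elements are triples in \<open>E\<^sup>* + E + \<real> p\<close>; the bracket is the bilinear alternating one with
  \<open>[flat e, f] = b e f p\<close> and all other brackets between the summands zero.\<close>

type_synonym 'e heis = "('e \<Rightarrow>\<^sub>L real) \<times> 'e \<times> real"

definition heis_bracket ::
  "('e::euclidean_space \<Rightarrow> 'e \<Rightarrow> real) \<Rightarrow> 'e heis \<Rightarrow> 'e heis \<Rightarrow> 'e heis"
  where "heis_bracket b = (\<lambda>(\<alpha>, e, s) (\<beta>, f, t). (0, 0, b (inv flat \<alpha>) f - b (inv flat \<beta>) e))"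

definition heis_dual :: "('e::euclidean_space \<Rightarrow>\<^sub>L real) \<Rightarrow> 'e heis" where "heis_dual \<alpha> = (\<alpha>, 0, 0)"
definition heis_vec :: "'e::euclidean_space \<Rightarrow> 'e heis" where "heis_vec e = (0, e, 0)"
definition heis_p :: "'e::euclidean_space heis" where "heis_p = (0, 0, 1)"

definition nondegenerate :: "('e::real_vector \<Rightarrow> 'e \<Rightarrow> real) \<Rightarrow> bool"
  where "nondegenerate b \<longleftrightarrow> (\<forall>e. (\<forall>f. b e f = 0) \<longrightarrow> e = 0)"

lemma heis_bracket_dual_vec:
  assumes "bilinear b"
  shows "heis_bracket b (heis_dual (flat e)) (heis_vec f) = b e f *\<^sub>R heis_p"
  using assms inv_f_f[OF bij_is_inj[OF bij_flat], of e]
  by (simp add: heis_bracket_def heis_dual_def heis_vec_def heis_p_def bilinear_rzero)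

definition heis_representation ::
  "('e::euclidean_space \<Rightarrow> 'e \<Rightarrow> real) \<Rightarrow> ('e heis \<Rightarrow> 's::real_vector endo) \<Rightarrow> bool"
  where "heis_representation b \<rho> \<longleftrightarrow>
    linear \<rho> \<and> (\<forall>x y. \<rho> (heis_bracket b x y) = \<rho> x * \<rho> y - \<rho> y * \<rho> x)"

text \<open>Here \<open>\<pi>\<close> is the Clifford module structure on \<open>S\<^sub>-\<close> and on \<open>S\<^sub>+\<close>, and \<open>b = - neg_inner (B _) _\<close>.\<close>

definition spin_representation ::
  "('e::euclidean_space clifford \<Rightarrow> 's::real_vector endo) \<Rightarrow> ('e \<Rightarrow> 'e \<Rightarrow> real) \<Rightarrow> ('e \<Rightarrow> 'e) \<Rightarrow>
   ('e heis \<Rightarrow> ('s \<times> 's) endo) \<Rightarrow> bool"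
  where "spin_representation \<pi> b B \<rho> \<longleftrightarrow> heis_representation b \<rho> \<and>
    (\<forall>e. \<rho> (heis_dual (flat e)) = block 0 (sqrt 2 *\<^sub>R \<pi> (cl_vec (B e))) 0 0)"

definition suitable ::
  "('e::real_vector \<Rightarrow> 's::real_vector endo) \<Rightarrow> ('e \<Rightarrow> 's endo) \<Rightarrow> ('e \<Rightarrow> 's endo) \<Rightarrow> bool"
  where "suitable \<rho>11 \<rho>22 \<rho>12 \<longleftrightarrow>
    (\<forall>e f. \<rho>11 e * \<rho>12 f - \<rho>12 f * \<rho>22 e = \<rho>11 f * \<rho>12 e - \<rho>12 e * \<rho>22 f)"

text \<open>For \<open>u = Im h\<close>: \<open>Im h\<^sub>3\<close> has rank at most one, or its image is the orthogonal plane of \<open>u\<close>.\<close>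

definition rank_condition :: "('e::real_vector \<Rightarrow> quat) \<Rightarrow> real^3 \<Rightarrow> bool"
  where "rank_condition h3 u \<longleftrightarrow>
    dim (range (\<lambda>e. qIm (h3 e))) \<le> 1 \<or> range (\<lambda>e. qIm (h3 e)) = {x. orthogonal u x}"

end

theory Submission
  imports Defs
begin

text \<open>
  Write \<open>\<rho>(f)\<close> in blocks, with diagonal \<open>a f\<close>, \<open>g f\<close>. The bracket of \<open>E\<^sup>*\<close> with \<open>E\<close> forces \<open>\<rho>(f)\<close> to
  be block triangular and \<open>\<rho>(p)\<close> to be \<open>\<surd>2 P\<close> in the upper right corner, where for all \<open>u\<close>, \<open>f\<close>
  \<open>u g(f) - a(f) u = (u \<bullet> f) P\<close>; this is called the charge equation below.
  The solutions of this equation are found with Clifford algebra alone. For orthogonal \<open>u\<close>, \<open>f\<close> it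
  shows that \<open>P\<close> commutes with \<open>u f\<close>. An operator commuting with all such products is a sum
  \<open>h\<^sub>1 + h\<^sub>2 \<omega>\<close> with \<open>h\<^sub>1\<close>, \<open>h\<^sub>2\<close> in the Schur algebra: split it into the parts that commute and
  anticommute with vectors; the volume element \<open>\<omega>\<close> turns the second kind into the first. Given \<open>P\<close>,
  the equation has the particular solution
  \<open>2a(f) = h\<^sub>2 f \<omega> - h\<^sub>1 f\<close>, \<open>2g(f) = h\<^sub>2 f \<omega> + h\<^sub>1 f\<close>, and the remainders \<open>A\<close>, \<open>G\<close> satisfy
  \<open>u G = A u\<close> for all \<open>u\<close>. Hence \<open>A\<close> again commutes with even products, so \<open>A = h\<^sub>3 + h\<^sub>4 \<omega>\<close>, \<open>G = h\<^sub>3 - h\<^sub>4 \<omega>\<close>.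

  The operators \<open>1\<close>, \<open>\<omega>\<close>, \<open>f\<close>, \<open>\<omega> f\<close> are independent over the Schur algebra, so the remaining brackets
  become equations between quaternions. From \<open>[\<rho>(p), \<rho>(f)] = 0\<close>, that is \<open>P g(f) = a(f) P\<close>, come
  \<open>h\<^sub>1\<^sup>2 + h\<^sub>2\<^sup>2 = 0\<close> and \<open>h\<^sub>1 h\<^sub>2 = h\<^sub>2 h\<^sub>1\<close>, whose non-zero solutions are \<open>h\<^sub>1 = \<plusminus> j h\<^sub>2\<close> with \<open>j\<close> an imaginary
  unit commuting with \<open>h\<^sub>2\<close>; the two alternatives of the theorem are \<open>h\<^sub>2\<close> not real, which determines
  \<open>j\<close> up to sign, and \<open>h\<^sub>2\<close> real. The same identity contains two linear equations relating \<open>h\<^sub>4\<close> to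
  \<open>h\<^sub>3\<close>, and they determine \<open>h\<^sub>4\<close>.
  From \<open>[a(e), a(f)] = 0\<close> comes \<open>[h\<^sub>3(e), h\<^sub>3(f)] = [h\<^sub>4(e), h\<^sub>4(f)]\<close>, so that the vector product of any
  two elements of \<open>Im h\<^sub>3(E)\<close> is a multiple of \<open>j\<close>, which implies the rank condition. Suitability of
  \<open>\<rho>\<^sub>1\<^sub>2\<close> is the off-diagonal block of \<open>[\<rho>(e), \<rho>(f)] = 0\<close>.
\<close>

section \<open>Quaternionic equations\<close>

lemma qRe_qIm_simps [simp]:
  "qRe 0 = 0" "qIm 0 = 0" "qRe 1 = 1" "qIm 1 = 0"
  "qRe (x + y) = qRe x + qRe y" "qIm (x + y) = qIm x + qIm y"
  "qRe (x - y) = qRe x - qRe y" "qIm (x - y) = qIm x - qIm y"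
  "qRe (- x) = - qRe x" "qIm (- x) = - qIm x"
  "qRe (r *\<^sub>R x) = r * qRe x" "qIm (r *\<^sub>R x) = r *\<^sub>R qIm x"
  "qRe (x * y) = qRe x * qRe y - qIm x \<bullet> qIm y"
  "qIm (x * y) = qRe x *\<^sub>R qIm y + qRe y *\<^sub>R qIm x + cross3 (qIm x) (qIm y)"
  by (simp_all add: zero_quat_def one_quat_def plus_quat_def minus_quat_def uminus_quat_def
      scaleR_quat_def times_quat_def)

lemma quat_eq_iff: "x = y \<longleftrightarrow> qRe x = qRe y \<and> qIm x = qIm y"
  by (auto intro: quat.expand)

lemma cross3_eq_0_iff_scaleR:
  assumes "v \<noteq> 0"
  shows "cross3 v w = 0 \<longleftrightarrow> (\<exists>t. w = t *\<^sub>R v)"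
  using assms by (auto simp: cross_eq_0 collinear_lemma cross_mult_right)

lemma double_eq_iff: "x + x = y + y \<longleftrightarrow> x = y" for x y :: "'a::real_vector"
  by (metis scaleR_2 scaleR_cancel_left zero_neq_numeral)

lemma double_eq_0: "x + x = 0 \<longleftrightarrow> x = 0" for x :: "'a::real_vector"
  using double_eq_iff[of x 0] by simp

text \<open>Two commuting quaternions have parallel imaginary parts, so they lie in one copy of the
  complex numbers, where \<open>h1\<^sup>2 + h2\<^sup>2\<close> factors as \<open>(h1 - j h2) (h1 + j h2)\<close>. If \<open>h2\<close> is not real,
  \<open>j\<close> is its normalised imaginary part; if \<open>h2\<close> is real, \<open>j\<close> is that of \<open>h1\<close>.\<close>

lemma cancelling_commuting_squares:
  fixes h1 h2 :: quat
  assumes sq: "h1 * h1 + h2 * h2 = 0" and comm: "h1 * h2 = h2 * h1" and nz: "h1 \<noteq> 0 \<or> h2 \<noteq> 0"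
  obtains (a) \<epsilon> :: real where "\<epsilon> \<in> {1, -1}" "qIm h2 \<noteq> 0"
      "h1 = \<epsilon> *\<^sub>R (of_real (norm (qIm h2)) - qRe h2 *\<^sub>R imag (qIm h2 /\<^sub>R norm (qIm h2)))"
    | (b) \<epsilon> :: real where "\<epsilon> \<in> {1, -1}" "qRe h1 = 0" "qIm h1 \<noteq> 0" "h2 = \<epsilon> *\<^sub>R of_real (norm (qIm h1))"
proof -
  obtain a A where h1: "h1 = Quat a A" by (cases h1)
  obtain x Y where h2: "h2 = Quat x Y" by (cases h2)
  have re: "a\<^sup>2 + x\<^sup>2 = A \<bullet> A + Y \<bullet> Y" and im: "a *\<^sub>R A + x *\<^sub>R Y = 0"
    using sq double_eq_iff[of "a *\<^sub>R A + x *\<^sub>R Y" 0]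
    by (auto simp: h1 h2 quat_eq_iff power2_eq_square cross_refl algebra_simps)
  have "cross3 A Y = cross3 Y A" using comm by (simp add: h1 h2 quat_eq_iff algebra_simps)
  then have cross: "cross3 Y A = 0"
    using cross_skew[of A Y] double_eq_iff[of "cross3 Y A" 0] by simp
  show thesis
  proof (cases "Y = 0")
    case True
    have "A \<noteq> 0" using re nz True by (auto simp: h1 h2 quat_eq_iff)
    with im True have a0: "a = 0" by simp
    with re True have "x\<^sup>2 = (norm A)\<^sup>2" by (simp add: power2_norm_eq_inner)
    then have "x = norm A \<or> x = - norm A" by (simp add: power2_eq_iff)
    then show thesis
      using b[of 1] b[of "-1"] \<open>A \<noteq> 0\<close> a0 True by (auto simp: h1 h2 quat_eq_iff of_real_def)
  next
    case False
    then obtain t where t: "A = t *\<^sub>R Y" using cross cross3_eq_0_iff_scaleR by blast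
    have x: "x = - a * t" using im False
      by (simp add: t eq_neg_iff_add_eq_0 add.commute flip: scaleR_add_left)
    have "(1 + t\<^sup>2) * (a\<^sup>2 - (norm Y)\<^sup>2) = 0"
      using re unfolding power2_norm_eq_inner by (simp add: t x algebra_simps power2_eq_square)
    moreover have "1 + t\<^sup>2 \<noteq> 0" by (metis power_one sum_power2_eq_zero_iff zero_neq_one)
    ultimately have "a\<^sup>2 = (norm Y)\<^sup>2" by simp
    then have "a = norm Y \<or> a = - norm Y" by (simp add: power2_eq_iff)
    then show thesis
      using a[of 1] a[of "-1"] False by (auto simp: h1 h2 t x quat_eq_iff of_real_def)
  qed
qed

text \<open>The assumptions say \<open>[h1, h3] + {h2, h4} = 0\<close> and \<open>[h2, h3] = {h1, h4}\<close>. Commutators are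
  imaginary, so the real parts give \<open>Re h1 Re h4 = Im h1 \<bullet> Im h4\<close> and the same with \<open>h2\<close> in place of
  \<open>h1\<close>; since \<open>h1 = \<plusminus> j h2\<close> with \<open>h2 \<noteq> 0\<close>, this forces \<open>Re h4 = 0\<close>. The imaginary part of the
  second equation then gives \<open>h4\<close>, because \<open>Re h1 = \<plusminus>|Im h2| \<noteq> 0\<close>.\<close>

lemma h4_if_h2_not_real:
  fixes h1 h2 h3 h4 :: quat
  assumes C: "h1 * h3 + h2 * h4 = h3 * h1 - h4 * h2" and D: "h2 * h3 - h1 * h4 = h3 * h2 + h4 * h1"
    and \<epsilon>: "\<epsilon> \<in> {1, -1::real}" and Y: "qIm h2 \<noteq> 0"
    and h1: "h1 = \<epsilon> *\<^sub>R (of_real (norm (qIm h2)) - qRe h2 *\<^sub>R imag (qIm h2 /\<^sub>R norm (qIm h2)))"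
  shows "h4 = \<epsilon> *\<^sub>R imag (cross3 (qIm h2) (qIm h3) /\<^sub>R norm (qIm h2))"
proof -
  obtain x Y where h2: "h2 = Quat x Y" by (cases h2)
  obtain r v where h3: "h3 = Quat r v" by (cases h3)
  obtain d D' where h4: "h4 = Quat d D'" by (cases h4)
  have Y0: "Y \<noteq> 0" using Y h2 by simp
  define a A where "a = \<epsilon> * norm Y" and "A = - (\<epsilon> * x / norm Y) *\<^sub>R Y"
  have h1': "h1 = Quat a A" by (simp add: h1 h2 a_def A_def quat_eq_iff of_real_def divide_inverse)
  have 1: "x * d = Y \<bullet> D'"
    using C by (simp add: h1' h2 h3 h4 quat_eq_iff inner_commute algebra_simps)
  have 2: "a * d = A \<bullet> D'"
    using D by (simp add: h1' h2 h3 h4 quat_eq_iff inner_commute algebra_simps)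
  have "cross3 Y v + cross3 Y v = (a *\<^sub>R D' + d *\<^sub>R A) + (a *\<^sub>R D' + d *\<^sub>R A)"
    using D cross_skew[of v Y] cross_skew[of D' A]
    by (simp add: h1' h2 h3 h4 quat_eq_iff algebra_simps)
  then have 3: "cross3 Y v = a *\<^sub>R D' + d *\<^sub>R A" using double_eq_iff by blast
  \<comment> \<open>Since \<open>A\<close> is a multiple of \<open>Y\<close>, the two real parts 1 and 2 combine to
    \<open>\<epsilon> |Y| d = - \<epsilon> x\<^sup>2 d / |Y|\<close>.\<close>
  have "\<epsilon> * (norm Y * norm Y + x * x) * d = 0"
    using 2 1[symmetric] Y0 by (simp add: a_def A_def field_simps)
  moreover have "norm Y * norm Y + x * x \<noteq> 0" using Y0 by (simp add: add_pos_nonneg less_imp_neq[symmetric])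
  ultimately have d: "d = 0" using \<epsilon> by auto
  show ?thesis
    using 3 \<epsilon> Y0 by (auto simp: h2 h3 h4 d quat_eq_iff a_def)
qed

text \<open>Here \<open>h2\<close> is a non-zero scalar, and \<open>[h1, h3] + {h2, h4} = 0\<close> can be solved for \<open>h4\<close>.\<close>

lemma h4_if_h2_real:
  fixes h1 h2 h3 h4 :: quat
  assumes C: "h1 * h3 + h2 * h4 = h3 * h1 - h4 * h2"
    and \<epsilon>: "\<epsilon> \<in> {1, -1::real}" and h1: "qRe h1 = 0" "qIm h1 \<noteq> 0"
    and h2: "h2 = \<epsilon> *\<^sub>R of_real (norm (qIm h1))"
  shows "h4 = - \<epsilon> *\<^sub>R imag (cross3 (qIm h1) (qIm h3) /\<^sub>R norm (qIm h1))"
proof -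
  obtain A where h1': "h1 = Quat 0 A" using h1 by (cases h1) auto
  obtain r v where h3: "h3 = Quat r v" by (cases h3)
  obtain d D' where h4: "h4 = Quat d D'" by (cases h4)
  define x where "x = \<epsilon> * norm A"
  have A0: "A \<noteq> 0" using h1 h1' by simp
  have h2': "h2 = Quat x 0" by (simp add: h2 h1' x_def quat_eq_iff of_real_def)
  have "x \<noteq> 0" using A0 \<epsilon> by (auto simp: x_def)
  then have d: "d = 0" using C by (simp add: h1' h2' h3 h4 quat_eq_iff inner_commute)
  have "cross3 A v = - (x *\<^sub>R D')"
    using C unfolding cross_skew[of v A] h1' h2' h3 h4 d
    by (simp add: quat_eq_iff cross_skew[of v A] vec_eq_iff forall_3)
  then show ?thesis using A0 \<epsilon>
    by (auto simp: h1' h3 h4 d quat_eq_iff x_def)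
qed

lemma cross3_cross3_common: "cross3 (cross3 j v) (cross3 j w) = (j \<bullet> cross3 v w) *\<^sub>R j"
  by (simp add: cross3_simps forall_3)

text \<open>If some vector of the image \<open>V\<close> has a component along \<open>u\<close>, its products with the
  other vectors of \<open>V\<close> are orthogonal to it and multiples of \<open>u\<close>, hence zero, so \<open>V\<close> is a line.
  Otherwise \<open>V\<close> lies in the plane orthogonal to \<open>u\<close> and is the whole plane as soon as its
  dimension exceeds one.\<close>

lemma rank_condition_if_cross3_parallel:
  assumes lin: "linear h3" and u: "u \<noteq> 0"
    and par: "\<And>e f. \<exists>t. cross3 (qIm (h3 e)) (qIm (h3 f)) = t *\<^sub>R u"
  shows "rank_condition h3 u"
proof -
  let ?V = "range (\<lambda>e. qIm (h3 e))"
  have "linear (\<lambda>e. qIm (h3 e))"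
    using lin by (auto intro!: linearI simp: linear_add linear_scale)
  then have sub: "subspace ?V" using linear_subspace_image subspace_UNIV by blast
  show ?thesis
  proof (cases "?V \<subseteq> {x. orthogonal u x}")
    case True
    have d: "dim {x. u \<bullet> x = 0} = 2" using dim_hyperplane[OF u] by simp
    have "?V = {x. u \<bullet> x = 0}" if "\<not> dim ?V \<le> 1"
      by (rule subspace_dim_equal[OF sub subspace_hyperplane]) (use True d that in \<open>auto simp: orthogonal_def\<close>)
    then show ?thesis by (auto simp: rank_condition_def orthogonal_def)
  next
    case False
    then obtain e where e: "u \<bullet> qIm (h3 e) \<noteq> 0" by (auto simp: orthogonal_def)
    have "qIm (h3 f) \<in> span {qIm (h3 e)}" for f
    proof -
      obtain t where t: "cross3 (qIm (h3 e)) (qIm (h3 f)) = t *\<^sub>R u" using par by blast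
      have "t * (u \<bullet> qIm (h3 e)) = 0"
        using arg_cong[OF t, of "\<lambda>z. z \<bullet> qIm (h3 e)"] dot_cross_self(1) by (simp add: inner_commute)
      with e t have "cross3 (qIm (h3 e)) (qIm (h3 f)) = 0" by simp
      moreover have "qIm (h3 e) \<noteq> 0" using e by auto
      ultimately show ?thesis using cross3_eq_0_iff_scaleR by (auto simp: span_singleton)
    qed
    then have "dim ?V \<le> dim {qIm (h3 e)}" by (intro dim_mono) auto
    also have "\<dots> \<le> 1" using dim_le_card'[of "{qIm (h3 e)}"] by simp
    finally show ?thesis by (simp add: rank_condition_def)
  qed
qed

text \<open>The commutator of imaginary quaternions is twice their vector product, and the product of
  \<open>u \<times> v\<close> and \<open>u \<times> w\<close> is a multiple of \<open>u\<close>. Thus \<open>[h3 e, h3 f] = [h4 e, h4 f]\<close> places all vector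
  products of imaginary parts of \<open>h3\<close> on the line of \<open>u\<close>.\<close>

lemma rank_condition_if_commuting:
  assumes lin: "linear h3" and u: "u \<noteq> 0" and \<epsilon>: "\<epsilon> \<in> {1, -1::real}"
    and h4: "\<And>e. h4 e = \<epsilon> *\<^sub>R imag (cross3 u (qIm (h3 e)) /\<^sub>R norm u)"
    and comm: "\<And>e f. h3 e * h3 f - h4 e * h4 f = h3 f * h3 e - h4 f * h4 e"
  shows "rank_condition h3 u"
proof (rule rank_condition_if_cross3_parallel[OF lin u])
  fix e f
  define v w where "v = qIm (h3 e)" and "w = qIm (h3 f)"
  have "qRe (h4 e) = 0" for e by (simp add: h4)
  then have "cross3 v w - cross3 (qIm (h4 e)) (qIm (h4 f)) = cross3 w v - cross3 (qIm (h4 f)) (qIm (h4 e))"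
    using arg_cong[OF comm[of e f], of qIm] by (simp add: v_def w_def)
  then have "cross3 v w = cross3 (qIm (h4 e)) (qIm (h4 f))"
    using double_eq_iff[of "cross3 v w - cross3 (qIm (h4 e)) (qIm (h4 f))" 0]
      cross_skew[of w v] cross_skew[of "qIm (h4 f)" "qIm (h4 e)"] by simp
  also have "\<dots> = (\<epsilon> / norm u * (\<epsilon> / norm u)) *\<^sub>R cross3 (cross3 u v) (cross3 u w)"
    by (simp add: h4 v_def w_def cross_mult_left cross_mult_right divide_inverse mult_ac)
  finally show "\<exists>t. cross3 (qIm (h3 e)) (qIm (h3 f)) = t *\<^sub>R u"
    unfolding v_def w_def cross3_cross3_common scaleR_scaleR by blast
qed

section \<open>Operators between Clifford actions with quaternionic centralizer\<close>

text \<open>Clifford multiplication \<open>c\<close> in an algebra, in which the elements commuting with all vectors form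
  a copy \<open>\<phi>\<close> of the quaternions, together with an anticommuting square root \<open>\<omega>\<close> of \<open>- 1\<close>. In
  dimension 6 modulo 8 the volume element is such an \<open>\<omega>\<close>.\<close>

locale quaternionic_clifford =
  fixes c :: "'e::euclidean_space \<Rightarrow> 'a::{real_algebra, monoid_mult}"
    and \<omega> :: 'a
    and \<phi> :: "quat \<Rightarrow> 'a"
  assumes linear_c: "linear c"
    and c_square: "c v * c v = (v \<bullet> v) *\<^sub>R 1"
    and linear_\<phi>: "linear \<phi>"
    and \<phi>_one: "\<phi> 1 = 1"
    and \<phi>_mult: "\<phi> (x * y) = \<phi> x * \<phi> y"
    and inj_\<phi>: "inj \<phi>"
    and \<phi>_c: "c v * \<phi> x = \<phi> x * c v"
    and centralizer: "(\<And>v. T * c v = c v * T) \<Longrightarrow> T \<in> range \<phi>"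
    and \<omega>_c: "\<omega> * c v = - (c v * \<omega>)"
    and \<omega>_\<phi>: "\<omega> * \<phi> x = \<phi> x * \<omega>"
    and \<omega>_square: "\<omega> * \<omega> = - 1"
begin

lemma anticommutator: "c u * c v + c v * c u = (2 * (u \<bullet> v)) *\<^sub>R 1"
proof -
  have "c (u + v) * c (u + v) = ((u + v) \<bullet> (u + v)) *\<^sub>R 1" by (rule c_square)
  then show ?thesis
    by (simp add: linear_add[OF linear_c] algebra_simps c_square inner_commute scaleR_2 flip: scaleR_scaleR)
qed

lemma c_orthogonal: "u \<bullet> v = 0 \<Longrightarrow> c v * c u = - (c u * c v)"
  using anticommutator[of u v] by (simp add: eq_neg_iff_add_eq_0 add.commute)

lemma c_cancel_left: "v \<noteq> 0 \<Longrightarrow> c v * x = c v * y \<Longrightarrow> x = y"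
proof -
  assume v: "v \<noteq> 0" and "c v * x = c v * y"
  then have "(c v * c v) * x = (c v * c v) * y" by (simp add: mult.assoc)
  then show "x = y" using v by (simp add: c_square)
qed

lemma c_cancel_right: "v \<noteq> 0 \<Longrightarrow> x * c v = y * c v \<Longrightarrow> x = y"
proof -
  assume v: "v \<noteq> 0" and "x * c v = y * c v"
  then have "x * (c v * c v) = y * (c v * c v)" by (simp flip: mult.assoc)
  then show "x = y" using v by (simp add: c_square)
qed

lemmas \<phi>_linear = linear_add[OF linear_\<phi>] linear_diff[OF linear_\<phi>] linear_neg[OF linear_\<phi>]
  linear_scale[OF linear_\<phi>] linear_0[OF linear_\<phi>]

text \<open>Rewriting moves scalars to the left and \<open>\<omega>\<close> to the right of each word, so that both
  sides of an identity reach the same form; \<open>z\<close> stands for the tail of a right-associated word.\<close>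

lemma normal_form:
  "c v * (\<phi> x * z) = \<phi> x * (c v * z)"
  "\<phi> x * (\<phi> y * z) = \<phi> (x * y) * z"
  "\<omega> * (c v * z) = - (c v * (\<omega> * z))"
  "\<omega> * (\<phi> x * z) = \<phi> x * (\<omega> * z)"
  "\<omega> * (\<omega> * z) = - z"
  by (simp_all add: \<phi>_c \<phi>_mult \<omega>_c \<omega>_\<phi> \<omega>_square flip: mult.assoc)

lemmas normalize = normal_form \<phi>_c \<phi>_mult[symmetric] \<omega>_c \<omega>_\<phi> \<omega>_square mult.assoc

text \<open>The two summands commute, respectively anticommute, with vectors.\<close>

lemma independent_even:
  assumes "\<phi> x + \<phi> y * \<omega> = 0"
  shows "x = 0 \<and> y = 0"
proof -
  obtain v :: 'e where v: "v \<noteq> 0" using nonempty_Basis nonzero_Basis by blast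
  have "c v * (\<phi> x + \<phi> y * \<omega>) - (\<phi> x + \<phi> y * \<omega>) * c v = c v * (\<phi> y * \<omega>) + c v * (\<phi> y * \<omega>)"
    by (simp add: normalize algebra_simps)
  then have "c v * (\<phi> y * \<omega>) = 0" using assms by (simp add: double_eq_0)
  then have "\<phi> y * \<omega> = 0" using c_cancel_left[OF v, of "\<phi> y * \<omega>" 0] by simp
  then have "\<phi> y * \<omega> * \<omega> = 0" by simp
  then have "\<phi> y = 0" by (simp add: mult.assoc \<omega>_square)
  with assms have "\<phi> x = \<phi> 0" "\<phi> y = \<phi> 0" by (simp_all add: \<phi>_linear)
  then show ?thesis using inj_\<phi> by (simp add: inj_eq)
qed

lemma coefficients_unique:
  assumes "\<phi> x + \<phi> y * \<omega> = \<phi> x' + \<phi> y' * \<omega>"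
  shows "x = x' \<and> y = y'"
  using independent_even[of "x - x'" "y - y'"] assms
  by (simp add: \<phi>_linear algebra_simps)

text \<open>Elements of even degree commute with \<open>\<omega>\<close> and those of odd degree anticommute with it, so
  the anticommutator with \<open>\<omega>\<close> isolates the even part.\<close>

lemma independent_even_odd:
  assumes "v \<noteq> 0" and "\<phi> x + \<phi> y * \<omega> + (\<phi> z + \<phi> w * \<omega>) * c v = 0"
  shows "x = 0 \<and> y = 0 \<and> z = 0 \<and> w = 0"
proof -
  let ?X = "\<phi> x + \<phi> y * \<omega>" and ?Y = "\<phi> z + \<phi> w * \<omega>"
  have "\<omega> * (?X + ?Y * c v) + (?X + ?Y * c v) * \<omega> = ?X * \<omega> + ?X * \<omega>"
    by (simp add: normalize algebra_simps)
  then have "?X * \<omega> = 0" using assms(2) by (simp add: double_eq_0)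
  then have "?X * \<omega> * \<omega> = 0" by simp
  then have "- ?X = 0" by (simp only: mult.assoc \<omega>_square mult_minus_right mult_1_right)
  then have X: "?X = 0" by (simp only: neg_equal_0_iff_equal)
  then have "?Y * c v = 0 * c v" using assms(2) by simp
  then have "?Y = 0" using assms(1) c_cancel_right by blast
  with X show ?thesis using independent_even by blast
qed

text \<open>Conjugation \<open>T \<mapsto> u T u\<close> by a unit vector is an involution of the centralizer of the even
  products that does not depend on \<open>u\<close>. Its fixed part commutes with every vector, and its
  antifixed part anticommutes with every vector, so that it lies in the Schur algebra after
  multiplication by \<open>\<omega>\<close>.\<close>

lemma even_centralizer:
  assumes comm: "\<And>u v. u \<bullet> v = 0 \<Longrightarrow> T * (c u * c v) = c u * c v * T"
  obtains x y where "T = \<phi> x + \<phi> y * \<omega>"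
proof -
  obtain u :: 'e where u: "u \<in> Basis" using nonempty_Basis by blast
  then have uu: "c u * c u = 1" by (simp add: c_square inner_Basis)
  have uu': "c u * (c u * z) = z" for z by (simp add: uu flip: mult.assoc)
  \<comment> \<open>\<open>T'\<close> satisfies \<open>T' v = v T\<close> and \<open>v T' = T v\<close>, checked for \<open>v = u\<close>, then for \<open>v\<close> orthogonal to
    \<open>u\<close>, then by linearity.\<close>
  define T' where "T' = c u * T * c u"
  have Tu: "T' * c u = c u * T" "c u * T' = T * c u"
    by (simp_all add: T'_def uu uu' mult.assoc)
  have Tv: "T' * c v = c v * T \<and> c v * T' = T * c v" if "u \<bullet> v = 0" for v
  proof
    have "T' * c v = c u * (T * (c u * c v))" by (simp add: T'_def mult.assoc)
    also have "\<dots> = c v * T" by (simp add: comm[OF that] uu' mult.assoc)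
    finally show "T' * c v = c v * T" .
    have "c v * T' = (c v * c u * T) * c u" by (simp add: T'_def mult.assoc)
    also have "\<dots> = T * (c v * c u) * c u" using comm[of v u] that by (simp add: inner_commute)
    also have "\<dots> = T * c v" by (simp add: uu mult.assoc)
    finally show "c v * T' = T * c v" .
  qed
  have T'T: "T' * c v = c v * T \<and> c v * T' = T * c v" for v
  proof -
    define w where "w = v - (u \<bullet> v) *\<^sub>R u"
    have w: "u \<bullet> w = 0" using u by (simp add: w_def inner_diff_right inner_Basis)
    have v: "c v = c w + (u \<bullet> v) *\<^sub>R c u"
      by (simp add: w_def linear_diff[OF linear_c] linear_scale[OF linear_c])
    show ?thesis unfolding v using Tv[OF w] Tu by (simp add: algebra_simps)
  qed
  have "T + T' \<in> range \<phi>"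
    by (rule centralizer) (use T'T in \<open>simp add: algebra_simps\<close>)
  moreover have "(T - T') * \<omega> \<in> range \<phi>"
  proof (rule centralizer)
    fix v
    have "(T - T') * \<omega> * c v = - ((T - T') * c v) * \<omega>" by (simp add: mult.assoc \<omega>_c)
    also have "- ((T - T') * c v) = c v * (T - T')" using T'T by (simp add: algebra_simps)
    finally show "(T - T') * \<omega> * c v = c v * ((T - T') * \<omega>)" by (simp add: mult.assoc)
  qed
  ultimately obtain p q where pq: "T + T' = \<phi> p" "(T - T') * \<omega> = \<phi> q" by blast
  have "- (\<phi> q * \<omega>) = T - T'" by (simp add: mult.assoc \<omega>_square flip: pq(2))
  then have "T + T = \<phi> p + \<phi> (-q) * \<omega>" using pq(1) by (simp add: \<phi>_linear algebra_simps)
  then have "(1/2) *\<^sub>R (T + T) = (1/2) *\<^sub>R (\<phi> p + \<phi> (-q) * \<omega>)" by simp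
  then have "T = \<phi> ((1/2) *\<^sub>R p) + \<phi> ((1/2) *\<^sub>R (-q)) * \<omega>"
    unfolding linear_scale[OF linear_\<phi>] by (simp add: scaleR_add_right flip: scaleR_add_left)
  then show thesis by (rule that)
qed

context
  fixes a g :: "'e \<Rightarrow> 'a" and P :: 'a
  assumes charge: "\<And>u f. c u * g f - a f * c u = (u \<bullet> f) *\<^sub>R P"
begin

text \<open>For \<open>u\<close> orthogonal to \<open>f\<close> the charge equation reads \<open>u g = a u\<close>, whence also \<open>g u = u a\<close>, and
  for \<open>u = f\<close> it gives \<open>|f|\<^sup>2 P = f g - a f\<close>. Both \<open>|f|\<^sup>2 P u f\<close> and \<open>|f|\<^sup>2 u f P\<close> then equal
  \<open>f u a f + |f|\<^sup>2 a u\<close>.\<close>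

lemma charge_form:
  obtains h1 h2 where "P = \<phi> h1 + \<phi> h2 * \<omega>"
proof (rule even_centralizer)
  fix u f :: 'e
  assume uf: "u \<bullet> f = 0"
  show "P * (c u * c f) = c u * c f * P"
  proof (cases "f = 0 \<or> u = 0")
    case True
    then show ?thesis by (auto simp: linear_0[OF linear_c])
  next
    case False
    have ff: "c f * g f = a f * c f + (f \<bullet> f) *\<^sub>R P" using charge[of f f] by (simp add: algebra_simps)
    have ug: "c u * g f = a f * c u" using charge[of u f] uf by simp
    then have "c u * (c u * g f) * c u = c u * (a f * c u) * c u" by simp
    then have "(c u * c u) * g f * c u = c u * a f * (c u * c u)" by (simp add: mult.assoc)
    then have gu: "g f * c u = c u * a f" using False by (simp add: c_square)
    have "(f \<bullet> f) *\<^sub>R (P * (c u * c f)) = - ((f \<bullet> f) *\<^sub>R P * c f * c u)"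
      using c_orthogonal[of f u] uf by (simp add: mult.assoc inner_commute)
    also have "(f \<bullet> f) *\<^sub>R P = c f * g f - a f * c f" by (simp add: ff)
    also have "- ((c f * g f - a f * c f) * c f * c u) = c f * (g f * c u) * c f + (f \<bullet> f) *\<^sub>R (a f * c u)"
      using c_orthogonal[of f u] uf by (simp add: algebra_simps inner_commute c_square[of f] flip: mult.assoc)
         (simp add: mult.assoc c_orthogonal[of f u] uf inner_commute c_square)
    also have "\<dots> = c f * c u * a f * c f + (f \<bullet> f) *\<^sub>R (c u * g f)" by (simp add: gu ug mult.assoc)
    also have "\<dots> = - (c u * c f * a f * c f) + c u * (c f * c f) * g f"
      using c_orthogonal[of f u] uf by (simp add: c_square inner_commute)
    also have "\<dots> = c u * c f * ((f \<bullet> f) *\<^sub>R P)"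
      by (simp add: mult.assoc ff algebra_simps flip: mult_scaleR_right)
    finally show ?thesis using False by simp
  qed
qed (use that in blast)

text \<open>After subtraction of the particular solution of the charge equation, the remainders satisfy
  \<open>u G = A u\<close> for every \<open>u\<close>, hence \<open>G u = u A\<close>, and \<open>A\<close> commutes with every product of two
  vectors.\<close>

lemma diagonal_form:
  assumes P: "P = \<phi> h1 + \<phi> h2 * \<omega>"
  obtains h3 h4 where
    "2 *\<^sub>R a f = \<phi> h3 - \<phi> h1 * c f + \<phi> h2 * c f * \<omega> + \<phi> h4 * \<omega>"
    "2 *\<^sub>R g f = \<phi> h3 + \<phi> h1 * c f + \<phi> h2 * c f * \<omega> - \<phi> h4 * \<omega>"
proof -
  define A where "A = 2 *\<^sub>R a f - (\<phi> h2 * c f * \<omega> - \<phi> h1 * c f)"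
  define G where "G = 2 *\<^sub>R g f - (\<phi> h2 * c f * \<omega> + \<phi> h1 * c f)"
  have swap: "c u * G = A * c u" for u
  proof -
    let ?s = "c u * c f + c f * c u"
    have "c u * G - A * c u = 2 *\<^sub>R (c u * g f - a f * c u) - (\<phi> h1 * ?s + \<phi> h2 * ?s * \<omega>)"
      by (simp add: A_def G_def normalize algebra_simps)
    also have "\<dots> = 0"
      unfolding charge anticommutator P by (simp add: algebra_simps)
    finally show ?thesis by simp
  qed
  have swap': "G * c u = c u * A" for u
  proof (cases "u = 0")
    case False
    have "c u * (G * c u) = A * (c u * c u)" by (simp add: swap flip: mult.assoc)
    also have "\<dots> = c u * (c u * A)" by (simp add: c_square flip: mult.assoc)
    finally show ?thesis using c_cancel_left[OF False] by blast
  qed (simp add: linear_0[OF linear_c])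
  have "A * (c u * c v) = c u * c v * A" for u v
  proof -
    have "A * (c u * c v) = c u * (G * c v)" by (simp flip: mult.assoc swap)
    then show ?thesis by (simp add: swap' mult.assoc)
  qed
  then obtain h3 h4 where A: "A = \<phi> h3 + \<phi> h4 * \<omega>" using even_centralizer by metis
  obtain v :: 'e where v: "v \<noteq> 0" using nonempty_Basis nonzero_Basis by blast
  have "c v * G = c v * (\<phi> h3 - \<phi> h4 * \<omega>)"
    unfolding swap A by (simp add: normalize algebra_simps)
  then have "G = \<phi> h3 - \<phi> h4 * \<omega>" using c_cancel_left[OF v] by blast
  with A have "2 *\<^sub>R a f = \<phi> h3 - \<phi> h1 * c f + \<phi> h2 * c f * \<omega> + \<phi> h4 * \<omega>"
    "2 *\<^sub>R g f = \<phi> h3 + \<phi> h1 * c f + \<phi> h2 * c f * \<omega> - \<phi> h4 * \<omega>"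
    by (simp_all add: A_def G_def algebra_simps)
  then show thesis by (rule that)
qed

end

text \<open>Multiplying out and sorting by degree, with \<open>\<omega>\<^sup>2 = - 1\<close>: the coefficients of \<open>1\<close> and \<open>\<omega>\<close> are
  the equations linear in \<open>h3\<close> and \<open>h4\<close>, those of \<open>v\<close> and \<open>\<omega> v\<close> the quadratic ones in \<open>h1\<close> and
  \<open>h2\<close>. The latter appear doubled because the terms of both sides have opposite signs.\<close>

lemma intertwining_equations:
  assumes v: "v \<noteq> 0"
    and eq: "(\<phi> h1 + \<phi> h2 * \<omega>) * (\<phi> h3 + \<phi> h1 * c v + \<phi> h2 * c v * \<omega> - \<phi> h4 * \<omega>)
      = (\<phi> h3 - \<phi> h1 * c v + \<phi> h2 * c v * \<omega> + \<phi> h4 * \<omega>) * (\<phi> h1 + \<phi> h2 * \<omega>)"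
  shows "h1 * h1 + h2 * h2 = 0" "h1 * h2 = h2 * h1"
    "h1 * h3 + h2 * h4 = h3 * h1 - h4 * h2" "h2 * h3 - h1 * h4 = h3 * h2 + h4 * h1"
proof -
  let ?x = "h1 * h3 + h2 * h4 - (h3 * h1 - h4 * h2)" and ?y = "h2 * h3 - h1 * h4 - (h3 * h2 + h4 * h1)"
  let ?z = "(h1 * h1 + h2 * h2) + (h1 * h1 + h2 * h2)"
    and ?w = "(h2 * h1 - h1 * h2) + (h2 * h1 - h1 * h2)"
  have "\<phi> ?x + \<phi> ?y * \<omega> + (\<phi> ?z + \<phi> ?w * \<omega>) * c v
      = (\<phi> h1 + \<phi> h2 * \<omega>) * (\<phi> h3 + \<phi> h1 * c v + \<phi> h2 * c v * \<omega> - \<phi> h4 * \<omega>)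
      - (\<phi> h3 - \<phi> h1 * c v + \<phi> h2 * c v * \<omega> + \<phi> h4 * \<omega>) * (\<phi> h1 + \<phi> h2 * \<omega>)"
    by (simp add: normalize \<phi>_linear algebra_simps)
  also have "\<dots> = 0" using eq by simp
  finally have "?x = 0 \<and> ?y = 0 \<and> ?z = 0 \<and> ?w = 0" by (rule independent_even_odd[OF v])
  then show "h1 * h1 + h2 * h2 = 0" "h1 * h2 = h2 * h1"
    "h1 * h3 + h2 * h4 = h3 * h1 - h4 * h2" "h2 * h3 - h1 * h4 = h3 * h2 + h4 * h1"
    by (simp_all add: double_eq_0)
qed

text \<open>Split the operators into the even part \<open>L\<close> and the odd part \<open>K\<close>. The relations between \<open>h1\<close> and
  \<open>h2\<close> make all products \<open>K e K f\<close> vanish, so the even part of the commutator is \<open>[L e, L f]\<close>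
  alone.\<close>

lemma even_commutator_equation:
  assumes h1: "h1 * h1 + h2 * h2 = 0" and comm: "h1 * h2 = h2 * h1"
    and A: "A = (\<lambda>e. \<phi> (h3 e) - \<phi> h1 * c e + \<phi> h2 * c e * \<omega> + \<phi> (h4 e) * \<omega>)"
    and eq: "A e * A f = A f * A e"
  shows "h3 e * h3 f - h4 e * h4 f = h3 f * h3 e - h4 f * h4 e"
proof -
  define L K where "L = (\<lambda>e. \<phi> (h3 e) + \<phi> (h4 e) * \<omega>)" and "K = (\<lambda>e. \<phi> h2 * c e * \<omega> - \<phi> h1 * c e)"
  have A': "A e = L e + K e" for e by (simp add: A L_def K_def)
  have KK: "K e * K f = 0" for e f
  proof -
    have "K e * K f = \<phi> (h1 * h1 + h2 * h2) * (c e * c f) + \<phi> (h2 * h1 - h1 * h2) * (c e * (c f * \<omega>))"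
      by (simp add: K_def normalize \<phi>_linear algebra_simps)
    then show ?thesis by (simp add: h1 comm \<phi>_linear)
  qed
  have \<omega>L: "\<omega> * L e = L e * \<omega>" and \<omega>K: "\<omega> * K e = - (K e * \<omega>)" for e
    by (simp_all add: L_def K_def normalize algebra_simps)
  have \<omega>LK: "\<omega> * (L e * z) = L e * (\<omega> * z)" "\<omega> * (K e * z) = - (K e * (\<omega> * z))" for e z
    by (simp_all add: \<omega>L \<omega>K flip: mult.assoc)
  define Z X where "Z = A e * A f - A f * A e" and "X = L e * L f - L f * L e"
  have "\<omega> * Z + Z * \<omega> = X * \<omega> + X * \<omega>"
    by (simp add: Z_def X_def A' KK \<omega>L \<omega>K \<omega>LK mult.assoc algebra_simps)
  then have "X * \<omega> = 0" using eq by (simp add: Z_def double_eq_0)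
  then have "X * \<omega> * \<omega> = 0" by simp
  then have "X = 0" by (simp add: mult.assoc \<omega>_square)
  moreover have "X = \<phi> (h3 e * h3 f - h4 e * h4 f - (h3 f * h3 e - h4 f * h4 e))
      + \<phi> (h3 e * h4 f + h4 e * h3 f - (h3 f * h4 e + h4 f * h3 e)) * \<omega>"
    by (simp add: X_def L_def normalize \<phi>_linear algebra_simps)
  ultimately have "h3 e * h3 f - h4 e * h4 f - (h3 f * h3 e - h4 f * h4 e) = 0"
    using independent_even by metis
  then show ?thesis by simp
qed

text \<open>The even coefficients of an element are unique, so they inherit linearity from it.\<close>

lemma linear_coefficient:
  assumes lin: "linear a"
    and form: "\<And>f. 2 *\<^sub>R a f = \<phi> (h3 f) - \<phi> h1 * c f + \<phi> h2 * c f * \<omega> + \<phi> (h4 f) * \<omega>"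
  shows "linear h3"
proof -
  have L: "\<phi> (h3 f) + \<phi> (h4 f) * \<omega> = 2 *\<^sub>R a f + \<phi> h1 * c f - \<phi> h2 * c f * \<omega>" for f
    by (simp add: form)
  show ?thesis
  proof (rule linearI)
    fix e f :: 'e and r :: real
    have "\<phi> (h3 (e + f)) + \<phi> (h4 (e + f)) * \<omega>
        = (\<phi> (h3 e) + \<phi> (h4 e) * \<omega>) + (\<phi> (h3 f) + \<phi> (h4 f) * \<omega>)"
      unfolding L by (simp add: linear_add[OF lin] linear_add[OF linear_c] algebra_simps)
    then have "\<phi> (h3 (e + f)) + \<phi> (h4 (e + f)) * \<omega> = \<phi> (h3 e + h3 f) + \<phi> (h4 e + h4 f) * \<omega>"
      by (simp add: \<phi>_linear algebra_simps)
    then show "h3 (e + f) = h3 e + h3 f" using coefficients_unique by blast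
    have "\<phi> (h3 (r *\<^sub>R e)) + \<phi> (h4 (r *\<^sub>R e)) * \<omega> = r *\<^sub>R (\<phi> (h3 e) + \<phi> (h4 e) * \<omega>)"
      unfolding L by (simp add: linear_scale[OF lin] linear_scale[OF linear_c] algebra_simps)
    then have "\<phi> (h3 (r *\<^sub>R e)) + \<phi> (h4 (r *\<^sub>R e)) * \<omega> = \<phi> (r *\<^sub>R h3 e) + \<phi> (r *\<^sub>R h4 e) * \<omega>"
      by (simp add: \<phi>_linear algebra_simps)
    then show "h3 (r *\<^sub>R e) = r *\<^sub>R h3 e" using coefficients_unique by blast
  qed
qed

theorem spin_blocks_classification:
  assumes lin: "linear a"
    and charge: "\<And>u f. c u * g f - a f * c u = (u \<bullet> f) *\<^sub>R P" and P0: "P \<noteq> 0"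
    and inter: "\<And>f. P * g f = a f * P"
    and comm: "\<And>e f. a e * a f = a f * a e"
  shows "\<exists>h1 h2 h3 h4 \<epsilon>. P = \<phi> h1 + \<phi> h2 * \<omega> \<and>
      (\<forall>e. a e = (1/2) *\<^sub>R (\<phi> (h3 e) - \<phi> h1 * c e + \<phi> h2 * c e * \<omega> + \<phi> (h4 e) * \<omega>)) \<and>
      (\<forall>e. g e = (1/2) *\<^sub>R (\<phi> (h3 e) + \<phi> h1 * c e + \<phi> h2 * c e * \<omega> - \<phi> (h4 e) * \<omega>)) \<and>
      linear h3 \<and> \<epsilon> \<in> {1, - 1} \<and>
      ((qIm h2 \<noteq> 0 \<and> rank_condition h3 (qIm h2) \<and>
        h1 = \<epsilon> *\<^sub>R (of_real (norm (qIm h2)) - qRe h2 *\<^sub>R imag (qIm h2 /\<^sub>R norm (qIm h2))) \<and>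
        (\<forall>e. h4 e = \<epsilon> *\<^sub>R imag (cross3 (qIm h2) (qIm (h3 e)) /\<^sub>R norm (qIm h2))))
       \<or>
       (qRe h1 = 0 \<and> qIm h1 \<noteq> 0 \<and> rank_condition h3 (qIm h1) \<and>
        h2 = \<epsilon> *\<^sub>R of_real (norm (qIm h1)) \<and>
        (\<forall>e. h4 e = - \<epsilon> *\<^sub>R imag (cross3 (qIm h1) (qIm (h3 e)) /\<^sub>R norm (qIm h1)))))"
proof -
  obtain h1 h2 where P: "P = \<phi> h1 + \<phi> h2 * \<omega>" using charge_form[of g a P] charge by blast
  have "\<exists>x y. 2 *\<^sub>R a f = \<phi> x - \<phi> h1 * c f + \<phi> h2 * c f * \<omega> + \<phi> y * \<omega> \<and>
      2 *\<^sub>R g f = \<phi> x + \<phi> h1 * c f + \<phi> h2 * c f * \<omega> - \<phi> y * \<omega>" for f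
    using diagonal_form[of g a P h1 h2 f] charge P by metis
  then obtain h3 h4 where
    a: "\<And>f. 2 *\<^sub>R a f = \<phi> (h3 f) - \<phi> h1 * c f + \<phi> h2 * c f * \<omega> + \<phi> (h4 f) * \<omega>" and
    g: "\<And>f. 2 *\<^sub>R g f = \<phi> (h3 f) + \<phi> h1 * c f + \<phi> h2 * c f * \<omega> - \<phi> (h4 f) * \<omega>"
    by metis
  have h3: "linear h3" using linear_coefficient[OF lin a] .
  have inter2: "P * (2 *\<^sub>R g f) = 2 *\<^sub>R a f * P" for f using inter[of f] by simp
  note inter_eqs = intertwining_equations[OF _ inter2[unfolded a g P]]
  obtain v :: 'e where v: "v \<noteq> 0" using nonempty_Basis nonzero_Basis by blast
  note sq = inter_eqs(1,2)[OF v]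
  \<comment> \<open>Comparing coefficients needs a non-zero vector; at \<open>f = 0\<close> the equations hold because \<open>h3\<close> and
    \<open>h4\<close> vanish there.\<close>
  have h0: "h3 0 = 0" using linear_0[OF h3] .
  have h4_0: "h4 0 = 0"
    using a[of 0] linear_0[OF lin] linear_0[OF linear_c] h0 independent_even[of "h3 0" "h4 0"] by simp
  have C: "h1 * h3 f + h2 * h4 f = h3 f * h1 - h4 f * h2"
    and D: "h2 * h3 f - h1 * h4 f = h3 f * h2 + h4 f * h1" for f
    using inter_eqs(3,4)[of f] h0 h4_0 by (cases "f = 0"; simp)+
  have even: "h3 e * h3 f - h4 e * h4 f = h3 f * h3 e - h4 f * h4 e" for e f
    by (rule even_commutator_equation[OF sq, where A = "\<lambda>e. 2 *\<^sub>R a e"]) (simp_all add: a[symmetric] comm)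
  have blocks: "a f = (1/2) *\<^sub>R (\<phi> (h3 f) - \<phi> h1 * c f + \<phi> h2 * c f * \<omega> + \<phi> (h4 f) * \<omega>)"
    "g f = (1/2) *\<^sub>R (\<phi> (h3 f) + \<phi> h1 * c f + \<phi> h2 * c f * \<omega> - \<phi> (h4 f) * \<omega>)" for f
    by (simp_all flip: a g)
  have nz: "h1 \<noteq> 0 \<or> h2 \<noteq> 0" using P P0 by (auto simp: \<phi>_linear)
  show ?thesis
  proof (cases rule: cancelling_commuting_squares[OF sq nz, case_names a b])
    case (a \<epsilon>)
    have h4: "h4 f = \<epsilon> *\<^sub>R imag (cross3 (qIm h2) (qIm (h3 f)) /\<^sub>R norm (qIm h2))" for f
      by (rule h4_if_h2_not_real[OF C D a])
    have "rank_condition h3 (qIm h2)"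
      by (rule rank_condition_if_commuting[OF h3 a(2,1) h4 even])
    with a h4 P blocks h3 show ?thesis by blast
  next
    case (b \<epsilon>)
    have h4: "h4 f = - \<epsilon> *\<^sub>R imag (cross3 (qIm h1) (qIm (h3 f)) /\<^sub>R norm (qIm h1))" for f
      by (rule h4_if_h2_real[OF C b])
    have "- \<epsilon> \<in> {1, -1}" using b(1) by auto
    then have "rank_condition h3 (qIm h1)"
      by (rule rank_condition_if_commuting[OF h3 b(3) _ h4 even])
    with b h4 P blocks h3 show ?thesis by blast
  qed
qed

end

section \<open>The volume element\<close>

lemma prod_list_anticommute:
  fixes x :: "'a::{real_algebra, monoid_mult}"
  assumes "\<And>y. y \<in> set ys \<Longrightarrow> y * x = - (x * y)"
  shows "prod_list ys * x = (- 1) ^ length ys *\<^sub>R (x * prod_list ys)"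
  using assms
proof (induction ys)
  case (Cons y ys)
  let ?s = "(- 1 :: real) ^ length ys" and ?p = "prod_list ys"
  have "?p * x = ?s *\<^sub>R (x * ?p)" using Cons by simp
  then have "prod_list (y # ys) * x = ?s *\<^sub>R (y * x * ?p)" by (simp add: mult.assoc)
  also have "y * x = - (x * y)" using Cons.prems by simp
  finally show ?case by (simp add: mult.assoc)
qed simp

text \<open>Moving the first factor of the second copy past the tail of the first costs one sign for
  each element of the tail; the exponents add up to a triangular number.\<close>

lemma prod_list_square:
  fixes xs :: "'a::{real_algebra, monoid_mult} list"
  assumes "sorted_wrt (\<lambda>x y. y * x = - (x * y)) xs" "\<And>x. x \<in> set xs \<Longrightarrow> x * x = 1"
  shows "prod_list xs * prod_list xs = (- 1) ^ (length xs * (length xs - 1) div 2) *\<^sub>R 1"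
  using assms
proof (induction xs)
  case (Cons x xs)
  let ?p = "prod_list xs" and ?n = "length xs"
  have "?p * x = (- 1) ^ ?n *\<^sub>R (x * ?p)"
    by (rule prod_list_anticommute) (use Cons.prems in auto)
  then have "x * ?p * (x * ?p) = (- 1) ^ ?n *\<^sub>R (x * x * (?p * ?p))"
    by (metis mult.assoc mult_scaleR_left mult_scaleR_right)
  also have "x * x = 1" using Cons.prems by simp
  also have "?p * ?p = (- 1) ^ (?n * (?n - 1) div 2) *\<^sub>R 1"
    by (rule Cons.IH) (use Cons.prems in auto)
  also have "(- 1) ^ ?n *\<^sub>R (1 * ((- 1) ^ (?n * (?n - 1) div 2) *\<^sub>R (1::'a)))
      = (- 1 :: real) ^ (?n + ?n * (?n - 1) div 2) *\<^sub>R 1"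
    by (simp add: power_add)
  also have "?n + ?n * (?n - 1) div 2 = Suc ?n * ?n div 2"
  proof -
    have "Suc ?n * ?n = ?n * 2 + ?n * (?n - 1)" by (cases ?n) (simp_all add: algebra_simps)
    then show ?thesis by simp
  qed
  finally show ?case by simp
qed simp

lemma orthonormal_basis_list_props:
  fixes es :: "'e::euclidean_space list"
  assumes "orthonormal_basis_list es"
  shows "sorted_wrt orthogonal es" "distinct es" "pairwise orthogonal (set es)" "\<And>e. e \<in> set es \<Longrightarrow> e \<bullet> e = 1"
    "span (set es) = UNIV"
proof -
  have len: "length es = DIM('e)" using assms by (simp add: orthonormal_basis_list_def)
  have inner: "es ! i \<bullet> es ! j = (if i = j then 1 else 0)" if "i < length es" "j < length es" for i j
    using assms that by (auto simp: orthonormal_basis_list_def neg_inner_def split: if_splits)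
  show "sorted_wrt orthogonal es" using inner by (simp add: sorted_wrt_iff_nth_less orthogonal_def)
  show d: "distinct es" unfolding distinct_conv_nth using inner by (metis zero_neq_one)
  show o: "pairwise orthogonal (set es)"
    unfolding pairwise_def orthogonal_def using inner by (metis in_set_conv_nth)
  show n: "e \<bullet> e = 1" if "e \<in> set es" for e using that inner by (metis in_set_conv_nth)
  have "independent (set es)" using pairwise_orthogonal_independent[OF o] n by fastforce
  then show "span (set es) = UNIV"
    using card_eq_dim[of "set es" UNIV] distinct_card[OF d] len by (auto simp: dim_UNIV)
qed

lemma clifford_action:
  fixes \<pi> :: "'e::euclidean_space clifford \<Rightarrow> 'a::{real_algebra, monoid_mult}"
  assumes hom: "alg_hom \<pi>"
  shows "linear (\<lambda>v. \<pi> (cl_vec v))" "\<pi> (cl_vec v) * \<pi> (cl_vec v) = (v \<bullet> v) *\<^sub>R 1"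
    "u \<bullet> v = 0 \<Longrightarrow> \<pi> (cl_vec v) * \<pi> (cl_vec u) = - (\<pi> (cl_vec u) * \<pi> (cl_vec v))"
proof -
  have lin: "linear \<pi>" using hom by (simp add: alg_hom_def)
  show c: "linear (\<lambda>v. \<pi> (cl_vec v))"
    using linear_compose[OF linear_cl_vec lin] by (simp add: o_def)
  show sq: "\<pi> (cl_vec v) * \<pi> (cl_vec v) = (v \<bullet> v) *\<^sub>R 1" for v
    using hom cl_vec_square[of v] by (metis alg_hom_def linear_scale[OF lin] neg_inner_def minus_minus)
  assume "u \<bullet> v = 0"
  then have "\<pi> (cl_vec u) * \<pi> (cl_vec v) + \<pi> (cl_vec v) * \<pi> (cl_vec u) = 0"
    using sq[of "u + v"] by (simp add: linear_add[OF c] algebra_simps sq inner_commute)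
  then show "\<pi> (cl_vec v) * \<pi> (cl_vec u) = - (\<pi> (cl_vec u) * \<pi> (cl_vec v))"
    by (simp add: eq_neg_iff_add_eq_0 add.commute)
qed

lemma alg_hom_cl_volume:
  "alg_hom \<pi> \<Longrightarrow> \<pi> (cl_volume es) = prod_list (map (\<lambda>v. \<pi> (cl_vec v)) es)"
  unfolding cl_volume_def by (induction es) (simp_all add: alg_hom_def)

text \<open>A basis vector anticommutes with all factors of the volume element except itself, hence with
  an odd number of them.\<close>

lemma volume_anticommutes:
  fixes es :: "'e::euclidean_space list"
  assumes hom: "alg_hom \<pi>" and es: "orthonormal_basis_list es" and even: "even DIM('e)"
  shows "\<pi> (cl_volume es) * \<pi> (cl_vec v) = - (\<pi> (cl_vec v) * \<pi> (cl_volume es))"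
proof -
  note es_props = orthonormal_basis_list_props[OF es]
  let ?c = "\<lambda>v. \<pi> (cl_vec v)" and ?w = "\<pi> (cl_volume es)"
  have len: "length es = DIM('e)" using es by (simp add: orthonormal_basis_list_def)
  have basis: "?w * ?c e = - (?c e * ?w)" if e: "e \<in> set es" for e
  proof -
    obtain xs ys where split: "es = xs @ e # ys" using split_list[OF e] by blast
    have anti: "?c y * ?c e = - (?c e * ?c y)" if "y \<in> set xs \<union> set ys" for y
    proof (rule clifford_action(3)[OF hom])
      have "y \<in> set es" "y \<noteq> e" using that es_props(2) by (auto simp: split)
      then show "e \<bullet> y = 0" using es_props(3) e by (auto simp: pairwise_def orthogonal_def)
    qed
    let ?p = "prod_list (map ?c xs)" and ?q = "prod_list (map ?c ys)"
    have p: "?p * ?c e = (- 1) ^ length xs *\<^sub>R (?c e * ?p)"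
      using prod_list_anticommute[of "map ?c xs" "?c e"] anti by auto
    have q: "?q * ?c e = (- 1) ^ length ys *\<^sub>R (?c e * ?q)"
      using prod_list_anticommute[of "map ?c ys" "?c e"] anti by auto
    have w: "?w = ?p * (?c e * ?q)" by (simp add: alg_hom_cl_volume[OF hom] split)
    have "?w * ?c e = (- 1) ^ length ys *\<^sub>R (?p * ?c e * (?c e * ?q))"
      by (simp add: w mult.assoc q)
    also have "\<dots> = ((- 1) ^ length ys * (- 1) ^ length xs) *\<^sub>R (?c e * ?w)"
      by (simp add: p w mult.assoc)
    also have "(- 1) ^ length ys * (- 1) ^ length xs = (- 1 :: real)"
    proof -
      have "odd (length ys + length xs)" using even len by (auto simp: split simp flip: len)
      then show ?thesis by (simp flip: power_add)
    qed
    finally show ?thesis by simp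
  qed
  note lin = clifford_action(1)[OF hom]
  have l1: "linear (\<lambda>v. ?w * ?c v)" and l2: "linear (\<lambda>v. - (?c v * ?w))"
    by (auto intro!: linearI simp: linear_add[OF lin] linear_scale[OF lin] algebra_simps)
  show ?thesis
    using linear_eq_on[OF l1 l2, of v "set es"] basis es_props(5) by auto
qed

lemma volume_square:
  fixes es :: "'e::euclidean_space list"
  assumes hom: "alg_hom \<pi>" and es: "orthonormal_basis_list es"
  shows "\<pi> (cl_volume es) * \<pi> (cl_volume es) = (- 1) ^ (DIM('e) * (DIM('e) - 1) div 2) *\<^sub>R 1"
proof -
  note es_props = orthonormal_basis_list_props[OF es]
  let ?c = "\<lambda>v. \<pi> (cl_vec v)"
  have "sorted_wrt (\<lambda>x y. y * x = - (x * y)) (map ?c es)"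
    unfolding sorted_wrt_map
    by (rule sorted_wrt_mono_rel[OF _ es_props(1)]) (simp add: clifford_action(3)[OF hom] orthogonal_def)
  moreover have "x * x = 1" if "x \<in> set (map ?c es)" for x
    using that es_props(4) clifford_action(2)[OF hom] by auto
  ultimately show ?thesis
    using prod_list_square[of "map ?c es"] es by (simp add: alg_hom_cl_volume[OF hom] orthonormal_basis_list_def)
qed

lemma volume_commutes_centralizer:
  assumes hom: "alg_hom \<pi>" and T: "T \<in> even_schur_algebra \<pi>"
  shows "\<pi> (cl_volume es) * T = T * \<pi> (cl_volume es)"
  unfolding alg_hom_cl_volume[OF hom]
proof (induction es)
  case (Cons e es)
  let ?c = "\<lambda>v. \<pi> (cl_vec v)" and ?p = "prod_list (map (\<lambda>v. \<pi> (cl_vec v)) es)"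
  have "?c e * ?p * T = ?c e * T * ?p" by (simp add: Cons.IH mult.assoc)
  also have "?c e * T = T * ?c e" using T by (simp add: even_schur_algebra_def)
  finally show ?case by (simp add: mult.assoc)
qed simp

section \<open>Block endomorphisms\<close>

lemma endo_eq_iff: "S = T \<longleftrightarrow> (\<forall>x. endo_app S x = endo_app T x)"
  by (simp add: endo_app_inject[symmetric] fun_eq_iff)

lemma endo_as_block:
  fixes T :: "('s::real_vector \<times> 's) endo"
  obtains A B C D where "T = block A B C D"
proof -
  have lin: "linear (endo_app T)" using endo_app by blast
  have fstlin: "linear fst" and sndlin: "linear snd" by (simp_all add: linear_fst linear_snd)
  have inl: "linear (\<lambda>x. (x, 0::'s))" and inr: "linear (\<lambda>x. (0::'s, x))" by (auto intro!: linearI)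
  let ?b = "\<lambda>p i. Endo (\<lambda>x. p (endo_app T (i x)))"
  have app: "endo_app (?b p i) = (\<lambda>x. p (endo_app T (i x)))" if "linear p" "linear i" for p :: "'s \<times> 's \<Rightarrow> 's" and i
    by (rule Endo_inverse) (use linear_compose[OF linear_compose[OF that(2) lin] that(1)] in \<open>simp add: o_def\<close>)
  have "T = block (?b fst (\<lambda>x. (x, 0))) (?b fst (\<lambda>x. (0, x))) (?b snd (\<lambda>x. (x, 0))) (?b snd (\<lambda>x. (0, x)))"
    unfolding endo_eq_iff
    by (simp add: block.rep_eq app[OF fstlin inl] app[OF fstlin inr] app[OF sndlin inl] app[OF sndlin inr] split_paired_all flip: fst_add snd_add linear_add[OF lin])
  then show thesis by (rule that)
qed

lemma block_eq_iff: "block A B C D = block A' B' C' D' \<longleftrightarrow> A = A' \<and> B = B' \<and> C = C' \<and> D = D'"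
proof
  assume eq: "block A B C D = block A' B' C' D'"
  have "endo_app (block A B C D) (x, y) = endo_app (block A' B' C' D') (x, y)" for x y
    by (simp add: eq)
  then have *: "endo_app A x + endo_app B y = endo_app A' x + endo_app B' y"
    "endo_app C x + endo_app D y = endo_app C' x + endo_app D' y" for x y
    by (simp_all add: block.rep_eq)
  have "endo_app T 0 = 0" for T :: "'a endo" using endo_app[of T] linear_0 by blast
  with *[of _ 0] *[of 0] show "A = A' \<and> B = B' \<and> C = C' \<and> D = D'"
    by (simp add: endo_eq_iff)
qed simp

lemma block_simps:
  fixes A B C D A' B' C' D' :: "'a::real_vector endo"
  shows
  "block A B C D * block A' B' C' D' = block (A * A' + B * C') (A * B' + B * D') (C * A' + D * C') (C * B' + D * D')"
  "block A B C D + block A' B' C' D' = block (A + A') (B + B') (C + C') (D + D')"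
  "block A B C D - block A' B' C' D' = block (A - A') (B - B') (C - C') (D - D')"
  "r *\<^sub>R block A B C D = block (r *\<^sub>R A) (r *\<^sub>R B) (r *\<^sub>R C) (r *\<^sub>R D)"
  "0 = block 0 0 0 (0 :: 'a endo)"
proof -
  have lin: "linear (endo_app T)" for T :: "'a endo" using endo_app by blast
  show "block A B C D * block A' B' C' D' = block (A * A' + B * C') (A * B' + B * D') (C * A' + D * C') (C * B' + D * D')"
  "block A B C D + block A' B' C' D' = block (A + A') (B + B') (C + C') (D + D')"
  "block A B C D - block A' B' C' D' = block (A - A') (B - B') (C - C') (D - D')"
  "r *\<^sub>R block A B C D = block (r *\<^sub>R A) (r *\<^sub>R B) (r *\<^sub>R C) (r *\<^sub>R D)"
  "0 = block 0 0 0 (0 :: 'a endo)"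
    by (simp_all add: endo_eq_iff block.rep_eq times_endo.rep_eq plus_endo.rep_eq minus_endo.rep_eq
        scaleR_endo.rep_eq zero_endo.rep_eq linear_add[OF lin] algebra_simps zero_prod_def)
qed

section \<open>Spin representations of the Heisenberg algebra\<close>

text \<open>Non-degeneracy makes \<open>B\<close> surjective, so the bracket of \<open>E\<^sup>*\<close> with \<open>E\<close> is known for every
  Clifford vector \<open>u = B e\<close>. Its left blocks give \<open>u d = 0\<close> for \<open>u\<close> orthogonal to \<open>f\<close>, which
  kills the lower left block \<open>d\<close> of \<open>\<rho>(f)\<close>, and its upper right block is the charge
  equation.\<close>

lemma spin_representation_blocks:
  fixes \<pi> :: "'e::euclidean_space clifford \<Rightarrow> 's::real_vector endo"
  assumes hom: "alg_hom \<pi>" and dim: "2 \<le> DIM('e)"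
    and b: "bilinear b" "nondegenerate b"
    and B: "linear B" "\<And>e f. b e f = - neg_inner (B e) f"
    and spin: "spin_representation \<pi> b B \<rho>"
  obtains a k g P where "linear a" "linear k"
    "\<rho> heis_p = sqrt 2 *\<^sub>R block 0 P 0 0" "\<And>e. \<rho> (heis_vec e) = block (a e) (k e) 0 (g e)"
    "\<And>u f. \<pi> (cl_vec u) * g f - a f * \<pi> (cl_vec u) = (u \<bullet> f) *\<^sub>R P"
    "\<And>f. P * g f = a f * P" "\<And>e f. a e * a f = a f * a e" "suitable a g k"
proof -
  let ?c = "\<lambda>v. \<pi> (cl_vec v)"
  have rep: "linear \<rho>" "\<And>x y. \<rho> (heis_bracket b x y) = \<rho> x * \<rho> y - \<rho> y * \<rho> x"
    and dual: "\<And>e. \<rho> (heis_dual (flat e)) = block 0 (sqrt 2 *\<^sub>R ?c (B e)) 0 0"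
    using spin by (auto simp: spin_representation_def heis_representation_def)
  have bB: "b e f = B e \<bullet> f" for e f using B(2) by (simp add: neg_inner_def)
  have "inj B"
    using b(2) by (auto simp: linear_injective_0[OF B(1)] nondegenerate_def bB)
  then have "surj B" using linear_injective_imp_surjective[OF B(1)] by blast
  have "\<exists>A K D G. \<rho> (heis_vec e) = block A K D G" for e using endo_as_block by metis
  then obtain a k d g where R: "\<And>e. \<rho> (heis_vec e) = block (a e) (k e) (d e) (g e)" by metis
  obtain P11 P12 P21 P22 where p: "\<rho> heis_p = block P11 P12 P21 P22" by (rule endo_as_block)
  define P where "P = (1 / sqrt 2) *\<^sub>R P12"
  have bracket: "block (sqrt 2 *\<^sub>R (?c u * d f)) (sqrt 2 *\<^sub>R (?c u * g f - a f * ?c u)) 0 (- (sqrt 2 *\<^sub>R (d f * ?c u)))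
      = (u \<bullet> f) *\<^sub>R block P11 P12 P21 P22" for u f
  proof -
    obtain e where e: "u = B e" using \<open>surj B\<close> by blast
    have "\<rho> (heis_bracket b (heis_dual (flat e)) (heis_vec f)) = (u \<bullet> f) *\<^sub>R \<rho> heis_p"
      by (simp add: heis_bracket_dual_vec[OF b(1)] linear_scale[OF rep(1)] bB e)
    then show ?thesis
      unfolding rep(2) dual R p e
      by (simp add: block_simps(1-4) block_eq_iff scaleR_diff_right)
  qed
  note bracket' = bracket[unfolded block_simps(4) block_eq_iff]
  have d0: "d f = 0" for f
  proof -
    obtain u where u: "u \<noteq> 0" "orthogonal f u" using orthogonal_to_vector_exists[OF dim] by blast
    then have "?c u * d f = 0" using bracket'[of u f] by (simp add: orthogonal_def inner_commute)
    then have "?c u * ?c u * d f = 0" by (simp add: mult.assoc)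
    then show ?thesis using u by (simp add: clifford_action(2)[OF hom])
  qed
  obtain v :: 'e where v: "v \<noteq> 0" using nonempty_Basis nonzero_Basis by blast
  have P: "P11 = 0" "P21 = 0" "P22 = 0" using bracket'[of v v] v by (simp_all add: d0)
  have vec_lin: "linear (heis_vec :: 'e \<Rightarrow> _)" by (auto intro!: linearI simp: heis_vec_def)
  have R': "\<rho> (heis_vec e) = block (a e) (k e) 0 (g e)" for e by (simp add: R d0)
  have p': "\<rho> heis_p = sqrt 2 *\<^sub>R block 0 P 0 0" by (simp add: p P P_def block_simps(4))
  have addR: "\<rho> (heis_vec (e + f)) = \<rho> (heis_vec e) + \<rho> (heis_vec f)"
    and scaleR: "\<rho> (heis_vec (r *\<^sub>R e)) = r *\<^sub>R \<rho> (heis_vec e)" for e f r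
    by (simp_all add: linear_add[OF vec_lin] linear_scale[OF vec_lin] linear_add[OF rep(1)] linear_scale[OF rep(1)])
  have "linear a" "linear k"
    using addR scaleR unfolding R' block_simps(2,4) block_eq_iff by (auto intro!: linearI)
  moreover have "?c u * g f - a f * ?c u = (u \<bullet> f) *\<^sub>R P" for u f
  proof -
    have "(1 / sqrt 2) *\<^sub>R (sqrt 2 *\<^sub>R (?c u * g f - a f * ?c u)) = (1 / sqrt 2) *\<^sub>R ((u \<bullet> f) *\<^sub>R P12)"
      using bracket'[of u f] by simp
    then show ?thesis by (simp add: P_def)
  qed
  moreover
  have flat0: "inv flat 0 = (0 :: 'e)"
    by (rule inv_f_eq[OF bij_is_inj[OF bij_flat]]) (rule blinfun_eqI, simp add: flat.rep_eq neg_inner_def)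
  have "heis_bracket b heis_p (heis_vec f) = 0" "heis_bracket b (heis_vec e) (heis_vec f) = 0" for e f
    by (simp_all add: heis_bracket_def heis_vec_def heis_p_def flat0 bilinear_lzero[OF b(1)] zero_prod_def)
  then have comm: "\<rho> heis_p * \<rho> (heis_vec f) = \<rho> (heis_vec f) * \<rho> heis_p"
    "\<rho> (heis_vec e) * \<rho> (heis_vec f) = \<rho> (heis_vec f) * \<rho> (heis_vec e)" for e f
    using rep(2) linear_0[OF rep(1)] by (metis eq_iff_diff_eq_0)+
  have "P * g f = a f * P" for f
    using comm(1)[of f] unfolding p' R' by (simp add: block_simps(1,4) block_eq_iff)
  moreover have "a e * a f = a f * a e \<and> a e * k f + k e * g f = a f * k e + k f * g e" for e f
    using comm(2)[of e f] unfolding R' by (simp add: block_simps(1) block_eq_iff)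
  then have "a e * a f = a f * a e" "suitable a g k" for e f
    unfolding suitable_def by (simp_all add: algebra_simps)
  ultimately show thesis using that p' R' by blast
qed

theorem theorem2p17:
  fixes \<pi> :: "'e::euclidean_space clifford \<Rightarrow> 's::real_vector endo"
    and \<phi> :: "quat \<Rightarrow> 's endo"
    and es :: "'e list"
    and \<omega> :: "'s endo"
    and b :: "'e \<Rightarrow> 'e \<Rightarrow> real"
    and B :: "'e \<Rightarrow> 'e"
    and \<rho> :: "'e heis \<Rightarrow> ('s \<times> 's) endo"
  assumes "DIM('e) mod 8 = 6"
    and "irreducible_clifford_module \<pi>"
    and "quat_identification \<pi> \<phi>"
    and "orthonormal_basis_list es"
    and "\<omega> = \<pi> (cl_volume es)"
    and "bilinear b" and "\<forall>e f. b e f = b f e" and "nondegenerate b"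
    and "linear B" and "\<forall>e f. b e f = - neg_inner (B e) f"
    and "spin_representation \<pi> b B \<rho>"
    and "\<rho> heis_p \<noteq> 0"
  shows "\<exists>(h1 :: quat) (h2 :: quat) (h3 :: 'e \<Rightarrow> quat) (h4 :: 'e \<Rightarrow> quat)
      (\<rho>11 :: 'e \<Rightarrow> 's endo) (\<rho>12 :: 'e \<Rightarrow> 's endo) (\<rho>22 :: 'e \<Rightarrow> 's endo) (\<epsilon> :: real).
      \<rho> heis_p = sqrt 2 *\<^sub>R block 0 (\<phi> h1 + \<phi> h2 * \<omega>) 0 0 \<and>
      (\<forall>e. \<rho> (heis_vec e) = block (\<rho>11 e) (\<rho>12 e) 0 (\<rho>22 e)) \<and>
      (\<forall>e. \<rho>11 e = (1/2) *\<^sub>R (\<phi> (h3 e) - \<phi> h1 * \<pi> (cl_vec e)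
                 + \<phi> h2 * \<pi> (cl_vec e) * \<omega> + \<phi> (h4 e) * \<omega>)) \<and>
      (\<forall>e. \<rho>22 e = (1/2) *\<^sub>R (\<phi> (h3 e) + \<phi> h1 * \<pi> (cl_vec e)
                 + \<phi> h2 * \<pi> (cl_vec e) * \<omega> - \<phi> (h4 e) * \<omega>)) \<and>
      linear \<rho>12 \<and> suitable \<rho>11 \<rho>22 \<rho>12 \<and>
      linear h3 \<and> \<epsilon> \<in> {1, - 1} \<and>
      ((qIm h2 \<noteq> 0 \<and> rank_condition h3 (qIm h2) \<and>
        h1 = \<epsilon> *\<^sub>R (of_real (norm (qIm h2)) - qRe h2 *\<^sub>R imag (qIm h2 /\<^sub>R norm (qIm h2))) \<and>
        (\<forall>e. h4 e = \<epsilon> *\<^sub>R imag (cross3 (qIm h2) (qIm (h3 e)) /\<^sub>R norm (qIm h2))))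
       \<or>
       (qRe h1 = 0 \<and> qIm h1 \<noteq> 0 \<and> rank_condition h3 (qIm h1) \<and>
        h2 = \<epsilon> *\<^sub>R of_real (norm (qIm h1)) \<and>
        (\<forall>e. h4 e = - \<epsilon> *\<^sub>R imag (cross3 (qIm h1) (qIm (h3 e)) /\<^sub>R norm (qIm h1)))))"
proof -
  let ?c = "\<lambda>v. \<pi> (cl_vec v)"
  have hom: "alg_hom \<pi>" using assms(2) by (simp add: irreducible_clifford_module_def)
  have \<phi>: "alg_hom \<phi>" "inj \<phi>" "range \<phi> = even_schur_algebra \<pi>"
    using assms(3) by (auto simp: quat_identification_def bij_betw_def)
  have range: "\<phi> x \<in> even_schur_algebra \<pi>" for x using \<phi>(3) by blast
  define m where "m = DIM('e) div 8"
  have dim: "DIM('e) = 8 * m + 6" using assms(1) by (simp add: m_def) presburger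
  have "DIM('e) * (DIM('e) - 1) div 2 = (4 * m + 3) * (8 * m + 5)" by (simp add: dim algebra_simps)
  then have odd: "odd (DIM('e) * (DIM('e) - 1) div 2)" by simp
  interpret quaternionic_clifford ?c \<omega> \<phi>
  proof (rule quaternionic_clifford.intro)
    show "linear ?c" using clifford_action(1)[OF hom] .
    show "linear \<phi>" "\<phi> 1 = 1" "inj \<phi>" using \<phi> by (auto simp: alg_hom_def)
    show "\<omega> * \<omega> = - 1"
      unfolding assms(5) volume_square[OF hom assms(4)] using odd by simp
  next
    fix v
    show "?c v * ?c v = (v \<bullet> v) *\<^sub>R 1" using clifford_action(2)[OF hom] .
    show "\<omega> * ?c v = - (?c v * \<omega>)"
      unfolding assms(5) by (rule volume_anticommutes[OF hom assms(4)]) (simp add: dim)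
  next
    fix v x
    show "?c v * \<phi> x = \<phi> x * ?c v" using range by (simp add: even_schur_algebra_def)
  next
    fix x
    show "\<omega> * \<phi> x = \<phi> x * \<omega>"
      unfolding assms(5) by (rule volume_commutes_centralizer[OF hom range])
  next
    fix x y
    show "\<phi> (x * y) = \<phi> x * \<phi> y" using \<phi>(1) by (simp add: alg_hom_def)
  next
    fix T
    assume "\<And>v. T * ?c v = ?c v * T"
    then show "T \<in> range \<phi>" by (simp add: \<phi>(3) even_schur_algebra_def)
  qed
  have dim2: "2 \<le> DIM('e)" by (simp add: dim)
  have bB: "b e f = - neg_inner (B e) f" for e f using assms(10) by blast
  obtain a k g P where "linear a" "linear k"
    and p: "\<rho> heis_p = sqrt 2 *\<^sub>R block 0 P 0 0"
    and R: "\<And>e. \<rho> (heis_vec e) = block (a e) (k e) 0 (g e)"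
    and charge: "\<And>u f. ?c u * g f - a f * ?c u = (u \<bullet> f) *\<^sub>R P"
    and inter: "\<And>f. P * g f = a f * P" and comm: "\<And>e f. a e * a f = a f * a e"
    and suit: "suitable a g k"
    by (rule spin_representation_blocks[OF hom dim2 assms(6,8,9) bB assms(11)]) (rule that)
  have "P \<noteq> 0" using p assms(12) by (auto simp flip: block_simps(5))
  from spin_blocks_classification[OF \<open>linear a\<close> charge this inter comm]
  obtain h1 h2 h3 h4 \<epsilon> where sol: "P = \<phi> h1 + \<phi> h2 * \<omega>"
      "\<forall>e. a e = (1/2) *\<^sub>R (\<phi> (h3 e) - \<phi> h1 * ?c e + \<phi> h2 * ?c e * \<omega> + \<phi> (h4 e) * \<omega>)"
      "\<forall>e. g e = (1/2) *\<^sub>R (\<phi> (h3 e) + \<phi> h1 * ?c e + \<phi> h2 * ?c e * \<omega> - \<phi> (h4 e) * \<omega>)"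
      "linear h3" "\<epsilon> \<in> {1, - 1}"
      "(qIm h2 \<noteq> 0 \<and> rank_condition h3 (qIm h2) \<and>
        h1 = \<epsilon> *\<^sub>R (of_real (norm (qIm h2)) - qRe h2 *\<^sub>R imag (qIm h2 /\<^sub>R norm (qIm h2))) \<and>
        (\<forall>e. h4 e = \<epsilon> *\<^sub>R imag (cross3 (qIm h2) (qIm (h3 e)) /\<^sub>R norm (qIm h2))))
       \<or>
       (qRe h1 = 0 \<and> qIm h1 \<noteq> 0 \<and> rank_condition h3 (qIm h1) \<and>
        h2 = \<epsilon> *\<^sub>R of_real (norm (qIm h1)) \<and>
        (\<forall>e. h4 e = - \<epsilon> *\<^sub>R imag (cross3 (qIm h1) (qIm (h3 e)) /\<^sub>R norm (qIm h1))))"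
    by (elim exE conjE) (rule that)
  have "\<forall>e. \<rho> (heis_vec e) = block (a e) (k e) 0 (g e)" using R by blast
  then show ?thesis
    using sol(2-) p[unfolded sol(1)] \<open>linear k\<close> suit
    by - (rule exI[of _ h1], rule exI[of _ h2], rule exI[of _ h3], rule exI[of _ h4],
        rule exI[of _ a], rule exI[of _ k], rule exI[of _ g], rule exI[of _ \<epsilon>], intro conjI; assumption)
qed

end
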